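(* Let $K\ge1$, $0=\tau_0<\tau_1<\dots<\tau_K$, $A_0,\dots,A_K\in\mathbb R^{n\times n}$, write $\tau=\tau_K$ and $I_i=[-\tau_i,-\tau_{i-1}]$, and let $d\ge0$ be an even integer. Suppose there exist $P\in\mathbb S^n$, $\eta>0$, and continuous functions $Q_i:\mathbb R\to\mathbb R^{n\times n}$, $S_i:\mathbb R\to\mathbb S^n$, $R_{ij}:\mathbb R^2\to\mathbb R^{n\times n}$ with $R_{ij}(\theta,\omega)=R_{ji}(\omega,\theta)^T$, $i,j=1,\dots,K$, such that $$(M_i)_{i}\in\tilde G_1^d,\qquad (R_{ij})_{i,j}\in\tilde G_2^d,\qquad (-D_i)_i\in\tilde G_3^d,\qquad (L_{ij})_{i,j}\in\tilde G_2^d,$$ where, for $i,j=1,\dots,K$, $$M_i(\theta)=\begin{bmatrix}P-\eta I&\tau Q_i(\theta)\\ \tau Q_i(\theta)^T&\tau S_i(\theta)\end{bmatrix},\qquad L_{ij}(\theta,\omega)=\frac{\partial}{\partial\theta}R_{ij}(\theta,\omega)+\frac{\partial}{\partial\omega}R_{ij}(\theta,\omega),$$ $$D_i(\theta)=\begin{bmatrix}E&\tau F_i(\theta)\\ \tau F_i(\theta)^T&-\tau\dot S_i(\theta)\end{bmatrix}.$$ Here $E$ is the symmetric $(K+1)\times(K+1)$ block matrix with $n\times n$ blocks $$E_{11}=PA_0+A_0^TP+Q_1(0)+Q_1(0)^T+S_1(0)+\eta I,$$ $$E_{1j}=E_{j1}^T=PA_{j-1}-Q_{j-1}(-\tau_{j-1})+Q_j(-\tau_{j-1})\quad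 (j=2,\dots,K),$$ $$E_{jj}=S_j(-\tau_{j-1})-S_{j-1}(-\tau_{j-1})\quad(j=2,\dots,K),$$ $$E_{1,K+1}=E_{K+1,1}^T=PA_K-Q_K(-\tau_K),\qquad E_{K+1,K+1}=-S_K(-\tau_K),$$ and all other blocks zero, and $$F_j(\theta)=\begin{bmatrix}R_{1j}(0,\theta)+A_0^TQ_j(\theta)-\dot Q_j(\theta)\\ R_{2j}(-\tau_1,\theta)-R_{1j}(-\tau_1,\theta)+A_1^TQ_j(\theta)\\ \vdots\\ R_{Kj}(-\tau_{K-1},\theta)-R_{(K-1)j}(-\tau_{K-1},\theta)+A_{K-1}^TQ_j(\theta)\\ A_K^TQ_j(\theta)-R_{Kj}(-\tau_K,\theta)\end{bmatrix}.$$ Then the solution map of $\dot x(t)=\sum_{i=0}^KA_ix(t-\tau_i)$ is asymptotically stable.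
   Context: $\mathbb S^m$: real symmetric $m\times m$ matrices; $\mathbb S^m_d[\theta]$: symmetric $m\times m$ matrices of real polynomials in $\theta$ of degree at most $d$. A family indexed by $i$ (or by $i,j$) represents the piecewise function equal to its $i$-th member on $I_i$ (its $(i,j)$-th member on $I_i\times I_j$). $\tilde G_1^d$ is the set of families $(N_i)_{i=1}^K$, $N_i\in\mathbb S_d^{2n}[\theta]$, for which there are $T_i\in\mathbb S_d^n[\theta]$ with $\sum_{i=1}^K\int_{-\tau_i}^{-\tau_{i-1}}T_i(\theta)\,d\theta=0$ and $N_i(\theta)+\begin{bmatrix}T_i(\theta)&0\\0&0\end{bmatrix}\ge0$ for all $\theta\in\mathbb R$, $i=1,\dots,K$. $\tilde G_3^d$ is the set of families $(N_i)_{i=1}^K$, $N_i\in\mathbb S_d^{n(K+2)}[\theta]$, for which there are $T_i\in\mathbb S_d^{n(K+1)}[\theta]$ with $\sum_{i=1}^K\int_{-\tau_i}^{-\tau_{i-1}}T_i(\theta)\,d\theta=0$ and $N_i(\theta)+\begin{bmatrix}T_i(\theta)&0\\0&0\end{bmatrix}\ge0$ for all $\theta\in\mathbb R$, $i=1,\dots,K$. For even $d$, $\tilde G_2^d$ is the set of families $(N_{ij})_{i,j=1}^K$ of $n\times n$ matrix functions for which there is a positive semidefinite $Q_0\in\mathbb S^{nK(d/2+1)}$ such that, with $\bar Z(\theta)=I_{nK}\otimes(1,\theta,\dots,\theta^{d/2})^T$ and $\hat R(\theta,\omega)=\bar Z(\theta)^TQ_0\bar Z(\omega)$ partitioned into $n\times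 n$ blocks $\hat R_{ij}$, $$N_{ij}(\theta,\omega)=\hat R_{ij}\Big(\tfrac{\tau_K}{\Delta_i}(\theta+\tau_{i-1}),\ \tfrac{\tau_K}{\Delta_j}(\omega+\tau_{j-1})\Big),\quad\Delta_i=\tau_i-\tau_{i-1},\qquad \theta\in I_i,\ \omega\in I_j.$$ Membership conditions only concern values on the intervals $I_i$ (and on $I_i\times I_j$), where the functions then coincide with polynomials; derivatives are taken there. $\mathcal C_{\tau_K}$ is the space of continuous functions $[-\tau_K,0]\to\mathbb R^n$ with the supremum norm; the solution map sends $\phi\in\mathcal C_{\tau_K}$ to the unique solution on $[-\tau_K,\infty)$ with $x=\phi$ on $[-\tau_K,0]$. Asymptotically stable (on $\mathcal C_{\tau_K}$) means: every solution is bounded; for every $\varepsilon>0$ there is $\delta>0$ such that $\|\phi\|<\delta$ implies $\sup_{t\ge-\tau_K}\|x(t)\|<\varepsilon$; and every solution satisfies $\lim_{t\to\infty}x(t)=0$. *)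

theory Defs
  imports "HOL-Analysis.Analysis" "HOL-Computational_Algebra.Polynomial"
begin

text \<open>
  A square matrix whose rows and columns are indexed by a finite set \<open>I\<close> is a function
  \<open>'i \<Rightarrow> 'i \<Rightarrow> real\<close> of which only the values on \<open>I \<times> I\<close> matter.  An \<open>nm \<times> nm\<close> matrix,
  with \<open>n = CARD('n)\<close>, uses the index set \<open>block_idx m\<close>: the pair \<open>(a, p)\<close> is component \<open>p\<close>
  of block \<open>a\<close>, and blocks are numbered from 1.
\<close>

definition block_idx :: "nat \<Rightarrow> (nat \<times> 'n::finite) set" where
  "block_idx m = {1..m} \<times> UNIV"

definition block_entry ::
  "(nat \<Rightarrow> nat \<Rightarrow> real^'n^'n) \<Rightarrow> nat \<times> 'n::finite \<Rightarrow> nat \<times> 'n \<Rightarrow> real" where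
  "block_entry B x y = B (fst x) (fst y) $ snd x $ snd y"

definition psd_on :: "'i set \<Rightarrow> ('i \<Rightarrow> 'i \<Rightarrow> real) \<Rightarrow> bool" where
  "psd_on I M \<longleftrightarrow>
     (\<forall>x\<in>I. \<forall>y\<in>I. M x y = M y x) \<and>
     (\<forall>v. 0 \<le> (\<Sum>x\<in>I. \<Sum>y\<in>I. v x * M x y * v y))"

definition sym_poly_mats :: "nat \<Rightarrow> 'i set \<Rightarrow> ('i \<Rightarrow> 'i \<Rightarrow> real poly) set" where
  "sym_poly_mats d I = {T. \<forall>x\<in>I. \<forall>y\<in>I. T x y = T y x \<and> degree (T x y) \<le> d}"

text \<open>\<open>[E, F; F\<^sup>T, G]\<close> with \<open>E\<close> of \<open>m \<times> m\<close> blocks, \<open>F\<close> a column of \<open>m\<close> blocks, \<open>G\<close> one block.\<close>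

definition bordered ::
  "nat \<Rightarrow> (nat \<Rightarrow> nat \<Rightarrow> real^'n^'n) \<Rightarrow> (nat \<Rightarrow> real^'n^'n) \<Rightarrow> real^'n^'n
     \<Rightarrow> nat \<Rightarrow> nat \<Rightarrow> real^'n^'n" where
  "bordered m E F G a b =
     (if a \<le> m \<and> b \<le> m then E a b
      else if a \<le> m then F a
      else if b \<le> m then transpose (F b)
      else G)"

definition delay_ivl :: "(nat \<Rightarrow> real) \<Rightarrow> nat \<Rightarrow> real set" where
  "delay_ivl \<tau> i = {- \<tau> i .. - \<tau> (i - 1)}"

text \<open>
  The common form of \<open>G\<^sub>1\<close> and \<open>G\<^sub>3\<close>: the families have \<open>(m+1) \<times> (m+1)\<close> blocks, the
  multipliers \<open>T\<^sub>i\<close> have \<open>m \<times> m\<close> blocks.  A family stands for the piecewise function equal to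
  its \<open>i\<close>-th member on \<open>I\<^sub>i\<close>, so a member \<open>N i\<close> only has to agree there with the polynomial
  matrix \<open>W i\<close>; positivity is required of the polynomial on the whole line.
\<close>

definition pos_families ::
  "nat \<Rightarrow> (nat \<Rightarrow> real) \<Rightarrow> nat \<Rightarrow> nat \<Rightarrow> (nat \<Rightarrow> real \<Rightarrow> nat \<Rightarrow> nat \<Rightarrow> real^'n^'n) set" where
  "pos_families m \<tau> K d = {N. \<exists>W T.
     (\<forall>i\<in>{1..K}. W i \<in> sym_poly_mats d (block_idx (m + 1))) \<and>
     (\<forall>i\<in>{1..K}. \<forall>\<theta>\<in>delay_ivl \<tau> i. \<forall>x\<in>block_idx (m + 1). \<forall>y\<in>block_idx (m + 1).
        block_entry (N i \<theta>) x y = poly (W i x y) \<theta>) \<and>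
     (\<forall>i\<in>{1..K}. T i \<in> sym_poly_mats d (block_idx m)) \<and>
     (\<forall>x\<in>block_idx m. \<forall>y\<in>block_idx m.
        (\<Sum>i=1..K. integral (delay_ivl \<tau> i) (poly (T i x y))) = 0) \<and>
     (\<forall>i\<in>{1..K}. \<forall>\<theta>::real.
        psd_on (block_idx (m + 1))
          (\<lambda>x y. poly (W i x y) \<theta> +
             (if x \<in> block_idx m \<and> y \<in> block_idx m then poly (T i x y) \<theta> else 0)))}"

definition G1 ::
  "(nat \<Rightarrow> real) \<Rightarrow> nat \<Rightarrow> nat \<Rightarrow> (nat \<Rightarrow> real \<Rightarrow> nat \<Rightarrow> nat \<Rightarrow> real^'n^'n) set" where
  "G1 \<tau> K d = pos_families 1 \<tau> K d"

definition G3 ::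
  "(nat \<Rightarrow> real) \<Rightarrow> nat \<Rightarrow> nat \<Rightarrow> (nat \<Rightarrow> real \<Rightarrow> nat \<Rightarrow> nat \<Rightarrow> real^'n^'n) set" where
  "G3 \<tau> K d = pos_families (K + 1) \<tau> K d"

text \<open>
  \<open>Zbar \<theta>\<close> is the Kronecker product of the identity with the column of the monomials
  \<open>\<theta>\<^sup>k\<close>, \<open>k \<le> d/2\<close>: its rows are indexed by pairs \<open>(x, k)\<close>, its columns by \<open>y\<close>.
\<close>

definition Zbar :: "real \<Rightarrow> 'i \<times> nat \<Rightarrow> 'i \<Rightarrow> real" where
  "Zbar \<theta> xk y = (if fst xk = y then 1 else 0) * \<theta> ^ snd xk"

definition kernel_idx :: "nat \<Rightarrow> nat \<Rightarrow> ((nat \<times> 'n::finite) \<times> nat) set" where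
  "kernel_idx K d = block_idx K \<times> {0..d div 2}"

definition Rhat ::
  "nat \<Rightarrow> nat \<Rightarrow> ((nat \<times> 'n::finite) \<times> nat \<Rightarrow> (nat \<times> 'n) \<times> nat \<Rightarrow> real)
     \<Rightarrow> real \<Rightarrow> real \<Rightarrow> nat \<times> 'n \<Rightarrow> nat \<times> 'n \<Rightarrow> real" where
  "Rhat K d Q\<^sub>0 \<theta> \<omega> x y =
     (\<Sum>u\<in>kernel_idx K d. \<Sum>v\<in>kernel_idx K d. Zbar \<theta> u x * Q\<^sub>0 u v * Zbar \<omega> v y)"

definition G2 ::
  "(nat \<Rightarrow> real) \<Rightarrow> nat \<Rightarrow> nat \<Rightarrow> (nat \<Rightarrow> nat \<Rightarrow> real \<Rightarrow> real \<Rightarrow> real^'n^'n) set" where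
  "G2 \<tau> K d = {N. \<exists>Q\<^sub>0. psd_on (kernel_idx K d) Q\<^sub>0 \<and>
     (\<forall>i\<in>{1..K}. \<forall>j\<in>{1..K}. \<forall>\<theta>\<in>delay_ivl \<tau> i. \<forall>\<omega>\<in>delay_ivl \<tau> j. \<forall>p q.
        N i j \<theta> \<omega> $ p $ q =
          Rhat K d Q\<^sub>0
            (\<tau> K / (\<tau> i - \<tau> (i - 1)) * (\<theta> + \<tau> (i - 1)))
            (\<tau> K / (\<tau> j - \<tau> (j - 1)) * (\<omega> + \<tau> (j - 1))) (i, p) (j, q))}"

definition M_fam ::
  "nat \<Rightarrow> (nat \<Rightarrow> real) \<Rightarrow> real^'n^'n \<Rightarrow> real \<Rightarrow> (nat \<Rightarrow> real \<Rightarrow> real^'n^'n)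
     \<Rightarrow> (nat \<Rightarrow> real \<Rightarrow> real^'n^'n) \<Rightarrow> nat \<Rightarrow> real \<Rightarrow> nat \<Rightarrow> nat \<Rightarrow> real^'n^'n" where
  "M_fam K \<tau> P \<eta> Q S i \<theta> =
     bordered 1 (\<lambda>_ _. P - \<eta> *\<^sub>R mat 1) (\<lambda>_. \<tau> K *\<^sub>R Q i \<theta>) (\<tau> K *\<^sub>R S i \<theta>)"

text \<open>
  Derivatives are taken within the intervals \<open>I\<^sub>i\<close> (one-sided at the end points).  The functions
  are only known to be differentiable there, where membership in \<open>G\<^sub>1\<close> or \<open>G\<^sub>2\<close> makes
  them polynomial.
\<close>

definition ivl_deriv ::
  "(nat \<Rightarrow> real) \<Rightarrow> (nat \<Rightarrow> real \<Rightarrow> real^'n^'n) \<Rightarrow> nat \<Rightarrow> real \<Rightarrow> real^'n^'n" where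
  "ivl_deriv \<tau> X i \<theta> = vector_derivative (X i) (at \<theta> within delay_ivl \<tau> i)"

definition L_fam ::
  "(nat \<Rightarrow> real) \<Rightarrow> (nat \<Rightarrow> nat \<Rightarrow> real \<Rightarrow> real \<Rightarrow> real^'n^'n)
     \<Rightarrow> nat \<Rightarrow> nat \<Rightarrow> real \<Rightarrow> real \<Rightarrow> real^'n^'n" where
  "L_fam \<tau> R i j \<theta> \<omega> =
     vector_derivative (\<lambda>s. R i j s \<omega>) (at \<theta> within delay_ivl \<tau> i) +
     vector_derivative (\<lambda>s. R i j \<theta> s) (at \<omega> within delay_ivl \<tau> j)"

definition E_row1 ::
  "nat \<Rightarrow> (nat \<Rightarrow> real) \<Rightarrow> (nat \<Rightarrow> real^'n^'n) \<Rightarrow> real^'n^'n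
     \<Rightarrow> (nat \<Rightarrow> real \<Rightarrow> real^'n^'n) \<Rightarrow> nat \<Rightarrow> real^'n^'n" where
  "E_row1 K \<tau> A P Q j =
     (if j \<le> K
      then P ** A (j - 1) - Q (j - 1) (- \<tau> (j - 1)) + Q j (- \<tau> (j - 1))
      else P ** A K - Q K (- \<tau> K))"

definition E_mat ::
  "nat \<Rightarrow> (nat \<Rightarrow> real) \<Rightarrow> (nat \<Rightarrow> real^'n^'n) \<Rightarrow> real^'n^'n \<Rightarrow> real
     \<Rightarrow> (nat \<Rightarrow> real \<Rightarrow> real^'n^'n) \<Rightarrow> (nat \<Rightarrow> real \<Rightarrow> real^'n^'n)
     \<Rightarrow> nat \<Rightarrow> nat \<Rightarrow> real^'n^'n" where
  "E_mat K \<tau> A P \<eta> Q S a b =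
     (if a = 1 \<and> b = 1 then
        P ** A 0 + transpose (A 0) ** P + Q 1 0 + transpose (Q 1 0) + S 1 0 + \<eta> *\<^sub>R mat 1
      else if a = 1 then E_row1 K \<tau> A P Q b
      else if b = 1 then transpose (E_row1 K \<tau> A P Q a)
      else if a = b then
        (if a \<le> K then S a (- \<tau> (a - 1)) - S (a - 1) (- \<tau> (a - 1)) else - S K (- \<tau> K))
      else 0)"

definition F_col ::
  "nat \<Rightarrow> (nat \<Rightarrow> real) \<Rightarrow> (nat \<Rightarrow> real^'n^'n) \<Rightarrow> (nat \<Rightarrow> real \<Rightarrow> real^'n^'n)
     \<Rightarrow> (nat \<Rightarrow> nat \<Rightarrow> real \<Rightarrow> real \<Rightarrow> real^'n^'n) \<Rightarrow> nat \<Rightarrow> real \<Rightarrow> nat \<Rightarrow> real^'n^'n" where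
  "F_col K \<tau> A Q R j \<theta> a =
     (if a = 1 then R 1 j 0 \<theta> + transpose (A 0) ** Q j \<theta> - ivl_deriv \<tau> Q j \<theta>
      else if a \<le> K then
        R a j (- \<tau> (a - 1)) \<theta> - R (a - 1) j (- \<tau> (a - 1)) \<theta> + transpose (A (a - 1)) ** Q j \<theta>
      else transpose (A K) ** Q j \<theta> - R K j (- \<tau> K) \<theta>)"

definition D_fam ::
  "nat \<Rightarrow> (nat \<Rightarrow> real) \<Rightarrow> (nat \<Rightarrow> real^'n^'n) \<Rightarrow> real^'n^'n \<Rightarrow> real
     \<Rightarrow> (nat \<Rightarrow> real \<Rightarrow> real^'n^'n) \<Rightarrow> (nat \<Rightarrow> real \<Rightarrow> real^'n^'n)
     \<Rightarrow> (nat \<Rightarrow> nat \<Rightarrow> real \<Rightarrow> real \<Rightarrow> real^'n^'n)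
     \<Rightarrow> nat \<Rightarrow> real \<Rightarrow> nat \<Rightarrow> nat \<Rightarrow> real^'n^'n" where
  "D_fam K \<tau> A P \<eta> Q S R i \<theta> =
     bordered (K + 1) (E_mat K \<tau> A P \<eta> Q S) (\<lambda>a. \<tau> K *\<^sub>R F_col K \<tau> A Q R i \<theta> a)
       (- (\<tau> K *\<^sub>R ivl_deriv \<tau> S i \<theta>))"

text \<open>The derivative at \<open>t = 0\<close> is the right derivative.\<close>

definition dde_solution ::
  "nat \<Rightarrow> (nat \<Rightarrow> real) \<Rightarrow> (nat \<Rightarrow> real^'n^'n) \<Rightarrow> (real \<Rightarrow> real^'n) \<Rightarrow> (real \<Rightarrow> real^'n) \<Rightarrow> bool" where
  "dde_solution K \<tau> A \<phi> x \<longleftrightarrow>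
     continuous_on {- \<tau> K..} x \<and>
     (\<forall>t\<in>{- \<tau> K..0}. x t = \<phi> t) \<and>
     (\<forall>t\<ge>0. (x has_vector_derivative (\<Sum>i=0..K. A i *v x (t - \<tau> i))) (at t within {0..}))"

definition dde_asymptotically_stable ::
  "nat \<Rightarrow> (nat \<Rightarrow> real) \<Rightarrow> (nat \<Rightarrow> real^'n^'n) \<Rightarrow> bool" where
  "dde_asymptotically_stable K \<tau> A \<longleftrightarrow>
     (\<forall>\<phi> x. continuous_on {- \<tau> K..0} \<phi> \<and> dde_solution K \<tau> A \<phi> x \<longrightarrow> bounded (x ` {- \<tau> K..})) \<and>
     (\<forall>\<epsilon>>0. \<exists>\<delta>>0. \<forall>\<phi> x. continuous_on {- \<tau> K..0} \<phi> \<and> dde_solution K \<tau> A \<phi> x \<longrightarrow>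
        (SUP t\<in>{- \<tau> K..0}. norm (\<phi> t)) < \<delta> \<longrightarrow> (SUP t\<in>{- \<tau> K..}. norm (x t)) < \<epsilon>) \<and>
     (\<forall>\<phi> x. continuous_on {- \<tau> K..0} \<phi> \<and> dde_solution K \<tau> A \<phi> x \<longrightarrow> (x \<longlongrightarrow> 0) at_top)"

end

theory Submission
  imports Defs
begin

text \<open>
  The proof exhibits a Lyapunov-Krasovskii functional.  Along a solution \<open>x\<close>, put
  \<open>V(t) = x(t)\<^sup>T P x(t) + \<Sum>\<^sub>i \<integral> 2 x(t)\<^sup>T Q\<^sub>i(\<theta>) x(t+\<theta>) + x(t+\<theta>)\<^sup>T S\<^sub>i(\<theta>) x(t+\<theta>) d\<theta>
  + \<Sum>\<^sub>i\<^sub>j \<integral>\<integral> x(t+\<theta>)\<^sup>T R\<^sub>i\<^sub>j(\<theta>,\<omega>) x(t+\<omega>) d\<theta> d\<omega>\<close>, with \<open>\<theta>\<close> ranging over \<open>I\<^sub>i\<close> and \<open>\<omega>\<close> over \<open>I\<^sub>j\<close>.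

  The two kinds of positivity hypotheses bound \<open>V\<close> and its derivative.  A family in \<open>G\<^sub>1\<close> or \<open>G\<^sub>3\<close>,
  inserted as a quadratic form in the constant vectors of the leading blocks and the value
  \<open>x(t+\<theta>)\<close> in the last one, has a nonnegative total integral: the multipliers \<open>T\<^sub>i\<close> meet
  only the constant vectors, so they integrate to zero and may be added for free
  (\<open>pos_families_integral_nonneg\<close>).  A kernel in \<open>G\<^sub>2\<close> is a positive semidefinite form in
  the polynomial moments of \<open>x(t+\<theta>)\<close> (\<open>G2_double_integral_nonneg\<close>).  Applied to \<open>M\<close> and
  \<open>R\<close>, these give \<open>V \<ge> \<eta> |x|\<^sup>2\<close> (\<open>V_lower\<close>).

  Differentiating \<open>V\<close> moves the derivative in \<open>t\<close> onto the kernels by integration by parts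
  (\<open>has_vector_derivative_sliding_integral\<close>), and the boundary terms involve exactly the delayed
  values \<open>x(t-\<tau>\<^sub>i)\<close>.  Collecting them (\<open>D_quadratic_form\<close>) shows
  \<open>V' = (1/\<tau>\<^sub>K) \<Sum>\<^sub>j \<integral> z\<^sup>T D\<^sub>j z - \<eta> |x|\<^sup>2 - \<Sum>\<^sub>i\<^sub>j \<integral>\<integral> x\<^sup>T L\<^sub>i\<^sub>j x\<close>, where \<open>z\<close> lists
  \<open>x(t), x(t-\<tau>\<^sub>1), \<dots>, x(t-\<tau>\<^sub>K), x(t+\<theta>)\<close>.  By the same positivity results for \<open>-D\<close> and \<open>L\<close>,
  \<open>V' \<le> -\<eta> |x|\<^sup>2\<close> (\<open>V_derivative\<close>).

  Since also \<open>V(0) \<le> C \<parallel>\<phi>\<parallel>\<^sup>2\<close>, solutions stay within a fixed multiple of \<open>\<parallel>\<phi>\<parallel>\<close>; hence \<open>x'\<close> is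
  bounded, \<open>x\<close> is Lipschitz, and if \<open>x\<close> did not tend to \<open>0\<close> then \<open>V\<close> would lose a fixed amount
  infinitely often, contradicting \<open>V \<ge> 0\<close> (\<open>tendsto_zero_of_dissipation\<close>).
\<close>

section \<open>Block quadratic forms\<close>

lemma inner_matrix_vector_entries:
  fixes H :: "real^'n^'n"
  shows "u \<bullet> (H *v v) = (\<Sum>p\<in>UNIV. \<Sum>q\<in>UNIV. u $ p * H $ p $ q * v $ q)"
  by (simp add: inner_vec_def matrix_vector_mult_def sum_distrib_left mult.assoc)

lemma block_quadratic_form:
  "(\<Sum>x\<in>block_idx m. \<Sum>y\<in>block_idx m.
      w (fst x) $ snd x * block_entry B x y * w (fst y) $ snd y)
   = (\<Sum>a=1..m. \<Sum>b=1..m. w a \<bullet> (B a b *v w b))"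
  unfolding block_idx_def block_entry_def inner_matrix_vector_entries
  unfolding sum.cartesian_product' fst_conv snd_conv
  by (intro sum.cong refl) (rule sum.swap)

lemma inner_transpose_matrix_vector:
  fixes H :: "real^'n^'n"
  shows "z \<bullet> (transpose H *v u) = u \<bullet> (H *v z)"
  by (metis dot_lmul_matrix inner_commute transpose_matrix_vector)

lemma bordered_quadratic_form:
  fixes E :: "nat \<Rightarrow> nat \<Rightarrow> real^'n^'n" and F :: "nat \<Rightarrow> real^'n^'n" and G :: "real^'n^'n" and m :: nat
  defines "B \<equiv> bordered m E F G"
  shows "(\<Sum>a=1..m+1. \<Sum>b=1..m+1. w a \<bullet> (B a b *v w b))
    = (\<Sum>a=1..m. \<Sum>b=1..m. w a \<bullet> (E a b *v w b))
      + 2 * (\<Sum>a=1..m. w a \<bullet> (F a *v w (m + 1)))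
      + w (m + 1) \<bullet> (G *v w (m + 1))"
proof -
  have "(\<Sum>a=1..m. \<Sum>b=1..m. w a \<bullet> (B a b *v w b)) = (\<Sum>a=1..m. \<Sum>b=1..m. w a \<bullet> (E a b *v w b))"
    by (intro sum.cong refl) (auto simp: B_def bordered_def)
  moreover have "(\<Sum>a=1..m. w a \<bullet> (B a (m+1) *v w (m+1))) = (\<Sum>a=1..m. w a \<bullet> (F a *v w (m+1)))"
    by (intro sum.cong refl) (auto simp: B_def bordered_def)
  moreover have "(\<Sum>b=1..m. w (m+1) \<bullet> (B (m+1) b *v w b)) = (\<Sum>a=1..m. w a \<bullet> (F a *v w (m+1)))"
    by (intro sum.cong refl) (auto simp: B_def bordered_def inner_transpose_matrix_vector simp del: transpose_matrix_vector)
  moreover have "B (m+1) (m+1) = G" by (simp add: B_def bordered_def)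
  ultimately show ?thesis by (simp add: sum.distrib)
qed

lemma matrix_vector_mult_minus_left:
  fixes H :: "real^'n^'n"
  shows "(- H) *v v = - (H *v v)"
  using matrix_vector_mult_diff_rdistrib[of 0 H v] by simp

lemma inner_transpose_matrix_mult:
  fixes A H :: "real^'n^'n"
  shows "z \<bullet> ((transpose A ** H) *v u) = (A *v z) \<bullet> (H *v u)"
  by (metis inner_transpose_matrix_vector inner_commute matrix_vector_mul_assoc)

section \<open>Positivity of the parametrized families\<close>

text \<open>
  The multiplier \<open>T\<^sub>i\<close> acts on the first \<open>m\<close> blocks alone, and these carry the constant vectors
  \<open>c\<close>.  Its contribution is therefore linear in the integral of \<open>T\<^sub>i\<close>, and the contributions of
  all intervals add up to zero; what remains to integrate is pointwise nonnegative.
\<close>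

lemma pos_families_integral_nonneg:
  fixes y :: "real \<Rightarrow> real^'n" and c :: "nat \<Rightarrow> real^'n"
  assumes N: "N \<in> pos_families m \<tau> K d"
    and y: "\<And>i. i \<in> {1..K} \<Longrightarrow> continuous_on (delay_ivl \<tau> i) y"
  defines "w \<equiv> \<lambda>\<theta> a. if a \<le> m then c a else y \<theta>"
  shows "0 \<le> (\<Sum>i=1..K. integral (delay_ivl \<tau> i)
      (\<lambda>\<theta>. \<Sum>a=1..m+1. \<Sum>b=1..m+1. w \<theta> a \<bullet> (N i \<theta> a b *v w \<theta> b)))"
proof -
  define J :: "(nat \<times> 'n) set" where "J = block_idx (m + 1)"
  define J0 :: "(nat \<times> 'n) set" where "J0 = block_idx m"
  have J0J: "J0 \<subseteq> J" and finJ: "finite J" by (auto simp: J_def J0_def block_idx_def)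
  obtain W T where
    "\<forall>i\<in>{1..K}. \<forall>\<theta>\<in>delay_ivl \<tau> i. \<forall>x\<in>J. \<forall>z\<in>J. block_entry (N i \<theta>) x z = poly (W i x z) \<theta>"
    and "\<forall>x\<in>J0. \<forall>z\<in>J0. (\<Sum>i=1..K. integral (delay_ivl \<tau> i) (poly (T i x z))) = 0"
    and "\<forall>i\<in>{1..K}. \<forall>\<theta>. psd_on J (\<lambda>x z. poly (W i x z) \<theta> +
             (if x \<in> J0 \<and> z \<in> J0 then poly (T i x z) \<theta> else 0))"
    using N[unfolded pos_families_def mem_Collect_eq, folded J_def J0_def]
    by (elim exE conjE) (rule that)
  note W = this(1)[rule_format] and T = this(2)[rule_format] and psd = this(3)[rule_format]
  define v where "v \<theta> x = w \<theta> (fst x) $ snd x" for \<theta> :: real and x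
  define g where "g i \<theta> = (\<Sum>x\<in>J. \<Sum>z\<in>J. v \<theta> x * poly (W i x z) \<theta> * v \<theta> z)" for i \<theta>
  define h where "h i \<theta> = (\<Sum>x\<in>J0. \<Sum>z\<in>J0. c (fst x) $ snd x * c (fst z) $ snd z * poly (T i x z) \<theta>)" for i \<theta>
  have vJ0: "v \<theta> x = c (fst x) $ snd x" if "x \<in> J0" for x \<theta>
    using that by (auto simp: v_def w_def J0_def block_idx_def)
  have quad: "(\<Sum>a=1..m+1. \<Sum>b=1..m+1. w \<theta> a \<bullet> (N i \<theta> a b *v w \<theta> b)) = g i \<theta>"
    if "i \<in> {1..K}" "\<theta> \<in> delay_ivl \<tau> i" for i \<theta>
    unfolding block_quadratic_form[symmetric] g_def v_def J_def[symmetric]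
    using W[OF that] by (intro sum.cong refl) auto
  have gh: "0 \<le> g i \<theta> + h i \<theta>" if "i \<in> {1..K}" for i \<theta>
  proof -
    have "0 \<le> (\<Sum>x\<in>J. \<Sum>z\<in>J. v \<theta> x * (poly (W i x z) \<theta> +
             (if x \<in> J0 \<and> z \<in> J0 then poly (T i x z) \<theta> else 0)) * v \<theta> z)"
      using psd[OF that, of \<theta>, unfolded psd_on_def, THEN conjunct2, THEN spec, of "v \<theta>"] .
    also have "\<dots> = g i \<theta> + (\<Sum>x\<in>J. \<Sum>z\<in>J. v \<theta> x *
             (if x \<in> J0 \<and> z \<in> J0 then poly (T i x z) \<theta> else 0) * v \<theta> z)"
      by (simp add: g_def ring_distribs sum.distrib)
    also have "(\<Sum>x\<in>J. \<Sum>z\<in>J. v \<theta> x *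
             (if x \<in> J0 \<and> z \<in> J0 then poly (T i x z) \<theta> else 0) * v \<theta> z)
        = (\<Sum>x\<in>J0. \<Sum>z\<in>J0. v \<theta> x * poly (T i x z) \<theta> * v \<theta> z)"
    proof (rule sum.mono_neutral_cong_right[OF finJ J0J])
      fix x assume "x \<in> J0"
      then show "(\<Sum>z\<in>J. v \<theta> x * (if x \<in> J0 \<and> z \<in> J0 then poly (T i x z) \<theta> else 0) * v \<theta> z)
          = (\<Sum>z\<in>J0. v \<theta> x * poly (T i x z) \<theta> * v \<theta> z)"
        by (intro sum.mono_neutral_cong_right[OF finJ J0J]) auto
    qed simp
    also have "\<dots> = h i \<theta>"
      unfolding h_def by (intro sum.cong refl) (simp add: vJ0)
    finally show ?thesis .
  qed
  have vcont: "continuous_on (delay_ivl \<tau> i) (\<lambda>\<theta>. v \<theta> x)" if "i \<in> {1..K}" for i x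
    using y[OF that] unfolding v_def w_def
    by (cases "fst x \<le> m") (auto intro!: continuous_intros)
  have gint: "g i integrable_on delay_ivl \<tau> i" if "i \<in> {1..K}" for i
    using vcont[OF that] unfolding g_def delay_ivl_def
    by (intro integrable_continuous_interval continuous_intros)
  have hint: "h i integrable_on delay_ivl \<tau> i" for i
    unfolding h_def delay_ivl_def
    by (intro integrable_continuous_interval continuous_intros)
  have pint: "poly (T i x z) integrable_on delay_ivl \<tau> i" for i x z
    unfolding delay_ivl_def by (intro integrable_continuous_interval continuous_intros)
  have "(\<Sum>i=1..K. integral (delay_ivl \<tau> i) (h i)) = (\<Sum>i=1..K. \<Sum>x\<in>J0. \<Sum>z\<in>J0.
      c (fst x) $ snd x * c (fst z) $ snd z * integral (delay_ivl \<tau> i) (poly (T i x z)))"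
  proof (intro sum.cong refl)
    fix i
    have fJ0: "finite J0" using J0J finJ finite_subset by blast
    show "integral (delay_ivl \<tau> i) (h i) = (\<Sum>x\<in>J0. \<Sum>z\<in>J0.
      c (fst x) $ snd x * c (fst z) $ snd z * integral (delay_ivl \<tau> i) (poly (T i x z)))"
      unfolding h_def
      by (intro integral_unique has_integral_sum has_integral_mult_right fJ0
          integrable_integral pint)
  qed
  also have "\<dots> = (\<Sum>x\<in>J0. \<Sum>z\<in>J0. c (fst x) $ snd x * c (fst z) $ snd z *
      (\<Sum>i=1..K. integral (delay_ivl \<tau> i) (poly (T i x z))))"
    unfolding sum_distrib_left by (subst sum.swap, intro sum.cong refl, rule sum.swap)
  also have "\<dots> = 0"
    by (intro sum.neutral ballI) (simp only: T mult_zero_right)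
  finally have h0: "(\<Sum>i=1..K. integral (delay_ivl \<tau> i) (h i)) = 0" .
  have "0 \<le> (\<Sum>i=1..K. integral (delay_ivl \<tau> i) (\<lambda>\<theta>. g i \<theta> + h i \<theta>))"
    by (intro sum_nonneg integral_nonneg integrable_add gint hint gh)
  also have "\<dots> = (\<Sum>i=1..K. integral (delay_ivl \<tau> i) (g i)) + (\<Sum>i=1..K. integral (delay_ivl \<tau> i) (h i))"
    unfolding sum.distrib[symmetric] by (intro sum.cong refl integral_add gint hint)
  also have "\<dots> = (\<Sum>i=1..K. integral (delay_ivl \<tau> i)
      (\<lambda>\<theta>. \<Sum>a=1..m+1. \<Sum>b=1..m+1. w \<theta> a \<bullet> (N i \<theta> a b *v w \<theta> b)))"
    unfolding h0 add_0_right
  proof (rule sum.cong[OF refl], rule integral_cong)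
    fix i \<theta> assume "i \<in> {1..K}" "\<theta> \<in> delay_ivl \<tau> i"
    from quad[OF this] show "g i \<theta> = (\<Sum>a=1..m+1. \<Sum>b=1..m+1. w \<theta> a \<bullet> (N i \<theta> a b *v w \<theta> b))"
      by (rule sym)
  qed
  finally show ?thesis .
qed

text \<open>
  Each column of \<open>Zbar\<close> has its only nonzero entries in the rows of its own component, so the
  matrix product collapses to a sum over pairs of exponents.
\<close>

lemma Rhat_monomials:
  fixes x z :: "nat \<times> 'n::finite"
  assumes "x \<in> block_idx K" "z \<in> block_idx K"
  shows "Rhat K d Q\<^sub>0 \<theta> \<omega> x z =
    (\<Sum>k\<le>d div 2. \<Sum>l\<le>d div 2. Q\<^sub>0 (x, k) (z, l) * \<theta> ^ k * \<omega> ^ l)"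
proof -
  have fin: "finite (block_idx K :: (nat \<times> 'n) set)" by (simp add: block_idx_def)
  have "Rhat K d Q\<^sub>0 \<theta> \<omega> x z = (\<Sum>x'\<in>block_idx K. \<Sum>k\<in>{0..d div 2}. \<Sum>z'\<in>block_idx K. \<Sum>l\<in>{0..d div 2}.
     if z = z' then (if x = x' then \<theta> ^ k * Q\<^sub>0 (x', k) (z', l) * \<omega> ^ l else 0) else 0)"
    unfolding Rhat_def kernel_idx_def sum.cartesian_product'
    by (intro sum.cong refl) (auto simp: Zbar_def)
  also have "\<dots> = (\<Sum>x'\<in>block_idx K. \<Sum>k\<in>{0..d div 2}. \<Sum>z'\<in>block_idx K. if z = z' then 
     (if x = x' then \<Sum>l\<in>{0..d div 2}. \<theta> ^ k * Q\<^sub>0 (x', k) (z', l) * \<omega> ^ l else 0) else 0)"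
    by (intro sum.cong refl) auto
  also have "\<dots> = (\<Sum>x'\<in>block_idx K. if x = x' then
      \<Sum>k\<in>{0..d div 2}. \<Sum>l\<in>{0..d div 2}. \<theta> ^ k * Q\<^sub>0 (x', k) (z, l) * \<omega> ^ l else 0)"
    using assms fin by (intro sum.cong refl) auto
  also have "\<dots> = (\<Sum>k\<in>{0..d div 2}. \<Sum>l\<in>{0..d div 2}. \<theta> ^ k * Q\<^sub>0 (x, k) (z, l) * \<omega> ^ l)"
    using assms fin by simp
  finally show ?thesis by (simp add: atLeast0AtMost mult_ac)
qed

text \<open>
  Separated kernels turn double integrals into sums of products of single integrals.  This makes
  positivity and differentiation of the double-integral part of the functional questions about
  finitely many moments, and avoids any exchange of integrals.
\<close>

lemma separable_double_integral:
  fixes N :: "real \<Rightarrow> real \<Rightarrow> real^'n^'n" and u v :: "real \<Rightarrow> real^'n"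
  assumes N: "\<And>\<theta> \<omega> p q. \<theta> \<in> {a..b} \<Longrightarrow> \<omega> \<in> {a'..b'} \<Longrightarrow>
      N \<theta> \<omega> $ p $ q = (\<Sum>r\<in>\<rho>. c p q r * f r \<theta> * g r \<omega>)"
    and cont: "continuous_on {a..b} u" "continuous_on {a'..b'} v"
      "\<And>r. continuous_on {a..b} (f r)" "\<And>r. continuous_on {a'..b'} (g r)"
    and fin: "finite \<rho>"
  shows "integral {a..b} (\<lambda>\<theta>. integral {a'..b'} (\<lambda>\<omega>. u \<theta> \<bullet> (N \<theta> \<omega> *v v \<omega>))) =
    (\<Sum>p\<in>UNIV. \<Sum>q\<in>UNIV. \<Sum>r\<in>\<rho>. c p q r * integral {a..b} (\<lambda>\<theta>. f r \<theta> * u \<theta> $ p)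
       * integral {a'..b'} (\<lambda>\<omega>. g r \<omega> * v \<omega> $ q))"
proof -
  define G where "G r q = integral {a'..b'} (\<lambda>\<omega>. g r \<omega> * v \<omega> $ q)" for r q
  have fi: "(\<lambda>\<theta>. f r \<theta> * u \<theta> $ p) integrable_on {a..b}" for r p
    by (intro integrable_continuous_interval continuous_intros cont)
  have gi: "((\<lambda>\<omega>. g r \<omega> * v \<omega> $ q) has_integral G r q) {a'..b'}" for r q
    unfolding G_def
    by (intro integrable_integral integrable_continuous_interval continuous_intros cont)
  have inner: "integral {a'..b'} (\<lambda>\<omega>. u \<theta> \<bullet> (N \<theta> \<omega> *v v \<omega>)) =
      (\<Sum>p\<in>UNIV. \<Sum>q\<in>UNIV. \<Sum>r\<in>\<rho>. c p q r * G r q * (f r \<theta> * u \<theta> $ p))"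
    if t: "\<theta> \<in> {a..b}" for \<theta>
  proof -
    have "integral {a'..b'} (\<lambda>\<omega>. u \<theta> \<bullet> (N \<theta> \<omega> *v v \<omega>)) = integral {a'..b'} (\<lambda>\<omega>.
        \<Sum>p\<in>UNIV. \<Sum>q\<in>UNIV. \<Sum>r\<in>\<rho>. (c p q r * f r \<theta> * u \<theta> $ p) * (g r \<omega> * v \<omega> $ q))"
      unfolding inner_matrix_vector_entries
      by (intro integral_cong sum.cong refl)
        (simp add: N[OF t] sum_distrib_left sum_distrib_right mult_ac)
    also have "\<dots> = (\<Sum>p\<in>UNIV. \<Sum>q\<in>UNIV. \<Sum>r\<in>\<rho>. (c p q r * f r \<theta> * u \<theta> $ p) * G r q)"
      by (intro integral_unique has_integral_sum has_integral_mult_right gi fin finite)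
    finally show ?thesis by (simp add: mult_ac)
  qed
  have "integral {a..b} (\<lambda>\<theta>. integral {a'..b'} (\<lambda>\<omega>. u \<theta> \<bullet> (N \<theta> \<omega> *v v \<omega>)))
      = integral {a..b} (\<lambda>\<theta>. \<Sum>p\<in>UNIV. \<Sum>q\<in>UNIV. \<Sum>r\<in>\<rho>. c p q r * G r q * (f r \<theta> * u \<theta> $ p))"
    by (intro integral_cong inner)
  also have "\<dots> = (\<Sum>p\<in>UNIV. \<Sum>q\<in>UNIV. \<Sum>r\<in>\<rho>. c p q r * G r q * integral {a..b} (\<lambda>\<theta>. f r \<theta> * u \<theta> $ p))"
    by (intro integral_unique has_integral_sum has_integral_mult_right integrable_integral fi fin finite)
  finally show ?thesis by (simp add: G_def mult_ac)
qed

text \<open>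
  The affine change of variable of \<open>G\<^sub>2\<close>, which stretches \<open>I\<^sub>i\<close> onto \<open>[-\<tau>\<^sub>K, 0]\<close>.
\<close>

definition seg_scale :: "(nat \<Rightarrow> real) \<Rightarrow> nat \<Rightarrow> nat \<Rightarrow> real \<Rightarrow> real" where
  "seg_scale \<tau> K i \<theta> = \<tau> K / (\<tau> i - \<tau> (i - 1)) * (\<theta> + \<tau> (i - 1))"

lemma continuous_on_seg_scale [continuous_intros]: "continuous_on X (seg_scale \<tau> K i)"
  unfolding seg_scale_def divide_inverse by (intro continuous_intros)

lemma G2_entries:
  fixes N :: "nat \<Rightarrow> nat \<Rightarrow> real \<Rightarrow> real \<Rightarrow> real^'n^'n"
  assumes "N \<in> G2 \<tau> K d"
  shows "\<exists>Q\<^sub>0 :: (nat \<times> 'n) \<times> nat \<Rightarrow> (nat \<times> 'n) \<times> nat \<Rightarrow> real. psd_on (kernel_idx K d) Q\<^sub>0 \<and>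
    (\<forall>i\<in>{1..K}. \<forall>j\<in>{1..K}. \<forall>\<theta>\<in>delay_ivl \<tau> i. \<forall>\<omega>\<in>delay_ivl \<tau> j. \<forall>p q.
        N i j \<theta> \<omega> $ p $ q = (\<Sum>r\<in>{..d div 2} \<times> {..d div 2}. Q\<^sub>0 ((i, p), fst r) ((j, q), snd r)
          * seg_scale \<tau> K i \<theta> ^ fst r * seg_scale \<tau> K j \<omega> ^ snd r))"
proof -
  have "Rhat K d Q\<^sub>0 \<theta> \<omega> (i, p) (j, q) = (\<Sum>r\<in>{..d div 2} \<times> {..d div 2}.
      Q\<^sub>0 ((i, p), fst r) ((j, q), snd r) * \<theta> ^ fst r * \<omega> ^ snd r)"
    if "i \<in> {1..K}" "j \<in> {1..K}" for Q\<^sub>0 \<theta> \<omega> i j and p q :: 'n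
    unfolding sum.cartesian_product' fst_conv snd_conv
    using that by (intro Rhat_monomials) (auto simp: block_idx_def)
  then show ?thesis
    using assms unfolding G2_def seg_scale_def by simp
qed

text \<open>
  By separability the double integral is \<open>\<mu>\<^sup>T Q\<^sub>0 \<mu>\<close>, where \<open>\<mu>\<close> collects the moments of
  the components of \<open>y\<close> against powers of the stretched variable.
\<close>

lemma G2_double_integral_nonneg:
  fixes N :: "nat \<Rightarrow> nat \<Rightarrow> real \<Rightarrow> real \<Rightarrow> real^'n^'n" and y :: "real \<Rightarrow> real^'n"
  assumes N: "N \<in> G2 \<tau> K d"
    and y: "\<And>i. i \<in> {1..K} \<Longrightarrow> continuous_on (delay_ivl \<tau> i) y"
  shows "0 \<le> (\<Sum>i=1..K. \<Sum>j=1..K. integral (delay_ivl \<tau> i)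
      (\<lambda>\<theta>. integral (delay_ivl \<tau> j) (\<lambda>\<omega>. y \<theta> \<bullet> (N i j \<theta> \<omega> *v y \<omega>))))"
proof -
  obtain Q\<^sub>0 :: "(nat \<times> 'n) \<times> nat \<Rightarrow> (nat \<times> 'n) \<times> nat \<Rightarrow> real" where psd: "psd_on (kernel_idx K d) Q\<^sub>0"
    and ent: "\<forall>i\<in>{1..K}. \<forall>j\<in>{1..K}. \<forall>\<theta>\<in>delay_ivl \<tau> i. \<forall>\<omega>\<in>delay_ivl \<tau> j. \<forall>p q.
        N i j \<theta> \<omega> $ p $ q = (\<Sum>r\<in>{..d div 2} \<times> {..d div 2}. Q\<^sub>0 ((i, p), fst r) ((j, q), snd r)
          * seg_scale \<tau> K i \<theta> ^ fst r * seg_scale \<tau> K j \<omega> ^ snd r)"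
    using G2_entries[OF N] by (elim exE conjE) (rule that)
  define \<mu> where "\<mu> x = integral (delay_ivl \<tau> (fst (fst x)))
     (\<lambda>\<theta>. seg_scale \<tau> K (fst (fst x)) \<theta> ^ snd x * y \<theta> $ snd (fst x))" for x
  have "(\<Sum>i=1..K. \<Sum>j=1..K. integral (delay_ivl \<tau> i)
      (\<lambda>\<theta>. integral (delay_ivl \<tau> j) (\<lambda>\<omega>. y \<theta> \<bullet> (N i j \<theta> \<omega> *v y \<omega>))))
    = (\<Sum>i=1..K. \<Sum>j=1..K. \<Sum>p\<in>UNIV. \<Sum>q\<in>UNIV. \<Sum>r\<in>{..d div 2} \<times> {..d div 2}.
        Q\<^sub>0 ((i, p), fst r) ((j, q), snd r) * \<mu> ((i, p), fst r) * \<mu> ((j, q), snd r))"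
  proof (intro sum.cong refl)
    fix i j assume ij: "i \<in> {1..K}" "j \<in> {1..K}"
    show "integral (delay_ivl \<tau> i) (\<lambda>\<theta>. integral (delay_ivl \<tau> j) (\<lambda>\<omega>. y \<theta> \<bullet> (N i j \<theta> \<omega> *v y \<omega>)))
      = (\<Sum>p\<in>UNIV. \<Sum>q\<in>UNIV. \<Sum>r\<in>{..d div 2} \<times> {..d div 2}.
        Q\<^sub>0 ((i, p), fst r) ((j, q), snd r) * \<mu> ((i, p), fst r) * \<mu> ((j, q), snd r))"
      unfolding \<mu>_def fst_conv snd_conv delay_ivl_def
    proof (rule separable_double_integral[where N = "N i j" and u = y and v = y
          and c = "\<lambda>p q r. Q\<^sub>0 ((i, p), fst r) ((j, q), snd r)"
          and f = "\<lambda>r \<theta>. seg_scale \<tau> K i \<theta> ^ fst r"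
          and g = "\<lambda>r \<omega>. seg_scale \<tau> K j \<omega> ^ snd r"])
      show "N i j \<theta> \<omega> $ p $ q = (\<Sum>r\<in>{..d div 2} \<times> {..d div 2}. Q\<^sub>0 ((i, p), fst r) ((j, q), snd r)
          * seg_scale \<tau> K i \<theta> ^ fst r * seg_scale \<tau> K j \<omega> ^ snd r)"
        if "\<theta> \<in> {- \<tau> i..- \<tau> (i - 1)}" "\<omega> \<in> {- \<tau> j..- \<tau> (j - 1)}" for \<theta> \<omega> p q
        using ent ij that unfolding delay_ivl_def by simp
    qed (use y[OF ij(1)] y[OF ij(2)] in \<open>unfold delay_ivl_def, auto intro!: continuous_intros\<close>)
  qed
  also have "\<dots> = (\<Sum>i=1..K. \<Sum>p\<in>UNIV. \<Sum>k\<le>d div 2. \<Sum>j=1..K. \<Sum>q\<in>UNIV. \<Sum>l\<le>d div 2.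
        Q\<^sub>0 ((i, p), k) ((j, q), l) * \<mu> ((i, p), k) * \<mu> ((j, q), l))" (is "?l = ?r")
  proof -
    have "?l = (\<Sum>i=1..K. \<Sum>j=1..K. \<Sum>p\<in>UNIV. \<Sum>q\<in>UNIV. \<Sum>k\<le>d div 2. \<Sum>l\<le>d div 2.
        Q\<^sub>0 ((i, p), k) ((j, q), l) * \<mu> ((i, p), k) * \<mu> ((j, q), l))"
      unfolding sum.cartesian_product' fst_conv snd_conv ..
    also have "\<dots> = ?r"
      by (simp only: sum.swap[where A = "{1..K}" and B = "UNIV :: 'n set"]
          sum.swap[where A = "{..d div 2}" and B = "UNIV :: 'n set"]
          sum.swap[where A = "{..d div 2}" and B = "{1..K}"])
    finally show ?thesis .
  qed
  also have "\<dots> = (\<Sum>x\<in>kernel_idx K d. \<Sum>z\<in>kernel_idx K d. \<mu> x * Q\<^sub>0 x z * \<mu> z)"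
    unfolding kernel_idx_def block_idx_def sum.cartesian_product' atLeast0AtMost
    by (intro sum.cong refl) (simp only: mult_ac)
  finally show ?thesis
    using psd[unfolded psd_on_def, THEN conjunct2, THEN spec, of \<mu>] by (simp only:)
qed

section \<open>Derivatives of integrals over a moving history\<close>

text \<open>
  The history \<open>g\<close> need not be differentiable, so the derivative cannot simply be taken under the
  integral.  With an antiderivative \<open>G\<close> of \<open>g\<close>, integration by parts rewrites the integral
  in terms of \<open>h'\<close> and \<open>G\<close>; that integrand is continuously differentiable in \<open>t\<close>, and
  Leibniz's rule applies.
\<close>

lemma has_vector_derivative_sliding_integral:
  fixes prod :: "'a::real_normed_vector \<Rightarrow> 'b::euclidean_space \<Rightarrow> 'c::banach"
  assumes bil: "bounded_bilinear prod" and ab: "a < b"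
    and h: "\<And>\<theta>. \<theta> \<in> {a..b} \<Longrightarrow> (h has_vector_derivative h' \<theta>) (at \<theta> within {a..b})"
    and h': "continuous_on {a..b} h'"
    and g: "continuous_on UNIV g"
  shows "((\<lambda>t. integral {a..b} (\<lambda>\<theta>. prod (h \<theta>) (g (t + \<theta>)))) has_vector_derivative
           prod (h b) (g (t + b)) - prod (h a) (g (t + a))
             - integral {a..b} (\<lambda>\<theta>. prod (h' \<theta>) (g (t + \<theta>)))) (at t within X)"
proof -
  interpret bounded_bilinear prod by (fact bil)
  define I where "I = {t - 1 + a .. t + 1 + b}"
  define U where "U = {t - 1 <..< t + 1}"
  obtain G where G: "\<And>s. s \<in> I \<Longrightarrow> (G has_vector_derivative g s) (at s within I)"
    using antiderivative_continuous[of "t - 1 + a" "t + 1 + b" g] g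
    unfolding I_def by (metis continuous_on_subset subset_UNIV)
  have Gat: "(G has_vector_derivative g s) (at s)" if "s \<in> {t - 1 + a <..< t + 1 + b}" for s
    using G[of s] that unfolding I_def by (auto simp: at_within_Icc_at)
  have hcont: "continuous_on {a..b} h"
    using h by (meson continuous_on_eq_continuous_within has_vector_derivative_continuous)
  have hat: "(h has_vector_derivative h' \<theta>) (at \<theta>)" if "\<theta> \<in> {a<..<b}" for \<theta>
    using h[of \<theta>] that by (auto simp: at_within_Icc_at)
  have gc: "continuous_on Y (\<lambda>y. g (k y))" if "continuous_on Y k" for k Y
    by (rule continuous_on_compose2[OF g that]) auto
  have Gsh: "((\<lambda>s. G (s + c)) has_vector_derivative g (s + c)) (at s within Y)"
    if "s \<in> U" "c \<in> {a..b}" for s c Y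
  proof -
    have "(G has_vector_derivative g (s + c)) (at (s + c))"
      using that by (intro Gat) (auto simp: U_def)
    moreover have "((\<lambda>s. s + c) has_vector_derivative 1) (at s)"
      by (auto intro!: derivative_eq_intros)
    ultimately have "((G \<circ> (\<lambda>s. s + c)) has_vector_derivative 1 *\<^sub>R g (s + c)) (at s)"
      using vector_diff_chain_at by blast
    then show ?thesis by (simp add: o_def has_vector_derivative_at_within)
  qed
  have Gsh2: "((\<lambda>\<theta>. G (s + \<theta>)) has_vector_derivative g (s + \<theta>)) (at \<theta>)"
    if "s \<in> U" "\<theta> \<in> {a..b}" for s \<theta>
  proof -
    have "(G has_vector_derivative g (s + \<theta>)) (at (s + \<theta>))"
      using that by (intro Gat) (auto simp: U_def)
    moreover have "((\<lambda>\<theta>. s + \<theta>) has_vector_derivative 1) (at \<theta>)"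
      by (auto intro!: derivative_eq_intros)
    ultimately have "((G \<circ> (\<lambda>\<theta>. s + \<theta>)) has_vector_derivative 1 *\<^sub>R g (s + \<theta>)) (at \<theta>)"
      using vector_diff_chain_at by blast
    then show ?thesis by (simp add: o_def)
  qed
  have Gcont: "continuous_on {a..b} (\<lambda>\<theta>. G (s + \<theta>))" if "s \<in> U" for s
    using Gsh2[OF that] 
    by (meson continuous_at_imp_continuous_on has_vector_derivative_continuous)
  have parts: "integral {a..b} (\<lambda>\<theta>. prod (h \<theta>) (g (s + \<theta>))) =
      prod (h b) (G (s + b)) - prod (h a) (G (s + a))
        - integral {a..b} (\<lambda>\<theta>. prod (h' \<theta>) (G (s + \<theta>)))" if s: "s \<in> U" for s
  proof -
    have int: "(\<lambda>\<theta>. prod (h \<theta>) (g (s + \<theta>))) integrable_on {a..b}"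
      by (intro integrable_continuous_interval continuous_on hcont gc continuous_intros)
    have "((\<lambda>\<theta>. prod (h' \<theta>) (G (s + \<theta>))) has_integral
        (prod (h b) (G (s + b)) - prod (h a) (G (s + a))
          - integral {a..b} (\<lambda>\<theta>. prod (h \<theta>) (g (s + \<theta>))))) {a..b}"
      by (rule integration_by_parts_interior[OF bil less_imp_le[OF ab] hcont Gcont[OF s],
            of h' "\<lambda>\<theta>. g (s + \<theta>)"])
        (use hat Gsh2[OF s] integrable_integral[OF int] in auto)
    then show ?thesis by (simp add: integral_unique algebra_simps)
  qed
  have leib: "((\<lambda>s. integral (cbox a b) (\<lambda>\<theta>. prod (h' \<theta>) (G (s + \<theta>)))) has_vector_derivative
      integral (cbox a b) (\<lambda>\<theta>. prod (h' \<theta>) (g (t + \<theta>)))) (at t within U)"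
  proof (rule leibniz_rule_vector_derivative)
    show "((\<lambda>s. prod (h' \<theta>) (G (s + \<theta>))) has_vector_derivative prod (h' \<theta>) (g (s + \<theta>)))
        (at s within U)" if "s \<in> U" "\<theta> \<in> cbox a b" for s \<theta>
      using that by (intro bounded_linear.has_vector_derivative[OF bounded_linear_right] Gsh) auto
    show "(\<lambda>\<theta>. prod (h' \<theta>) (G (s + \<theta>))) integrable_on cbox a b" if "s \<in> U" for s
      unfolding box_real using that
      by (intro integrable_continuous_interval continuous_on h' Gcont)
    have "continuous_on (U \<times> cbox a b) (\<lambda>z. prod (h' (snd z)) (g (fst z + snd z)))"
      by (intro continuous_on gc continuous_intros continuous_on_compose2[OF h']) auto
    then show "continuous_on (U \<times> cbox a b) (\<lambda>(s, \<theta>). prod (h' \<theta>) (g (s + \<theta>)))"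
      by (simp add: split_beta)
  qed (auto simp: U_def)
  have tU: "t \<in> U" and oU: "open U" by (auto simp: U_def)
  have "((\<lambda>s. prod (h b) (G (s + b)) - prod (h a) (G (s + a))
        - integral {a..b} (\<lambda>\<theta>. prod (h' \<theta>) (G (s + \<theta>)))) has_vector_derivative
      prod (h b) (g (t + b)) - prod (h a) (g (t + a))
        - integral {a..b} (\<lambda>\<theta>. prod (h' \<theta>) (g (t + \<theta>)))) (at t)"
  proof (intro has_vector_derivative_diff)
    show "((\<lambda>s. prod (h b) (G (s + b))) has_vector_derivative prod (h b) (g (t + b))) (at t)"
      using ab tU by (intro bounded_linear.has_vector_derivative[OF bounded_linear_right] Gsh) auto
    show "((\<lambda>s. prod (h a) (G (s + a))) has_vector_derivative prod (h a) (g (t + a))) (at t)"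
      using ab tU by (intro bounded_linear.has_vector_derivative[OF bounded_linear_right] Gsh) auto
    show "((\<lambda>s. integral {a..b} (\<lambda>\<theta>. prod (h' \<theta>) (G (s + \<theta>)))) has_vector_derivative
        integral {a..b} (\<lambda>\<theta>. prod (h' \<theta>) (g (t + \<theta>)))) (at t)"
      using leib unfolding box_real at_within_open[OF tU oU] .
  qed
  then have "((\<lambda>s. integral {a..b} (\<lambda>\<theta>. prod (h \<theta>) (g (s + \<theta>)))) has_vector_derivative
      prod (h b) (g (t + b)) - prod (h a) (g (t + a))
        - integral {a..b} (\<lambda>\<theta>. prod (h' \<theta>) (g (t + \<theta>)))) (at t)"
    by (rule has_vector_derivative_transform_within_open[OF _ oU tU]) (simp add: parts)
  then show ?thesis by (rule has_vector_derivative_at_within)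
qed

lemma has_vector_derivative_vec_componentwise:
  fixes f :: "real \<Rightarrow> 'a::euclidean_space^'n"
  assumes "\<And>i. ((\<lambda>s. f s $ i) has_vector_derivative f' i) (at t within X)"
  shows "(f has_vector_derivative (\<chi> i. f' i)) (at t within X)"
proof -
  have "((\<lambda>s. f s \<bullet> axis i u) has_derivative (\<lambda>s. (s *\<^sub>R (\<chi> i. f' i)) \<bullet> axis i u)) (at t within X)" for i u
    using has_derivative_inner_left[OF assms[of i, unfolded has_vector_derivative_def], of u]
    by (simp add: inner_axis)
  then show ?thesis
    unfolding has_vector_derivative_def
    by (subst has_derivative_componentwise_within) (auto simp: Basis_vec_def)
qed

lemma has_vector_derivative_matrix_componentwise:
  fixes f :: "real \<Rightarrow> real^'n^'m"
  assumes "\<And>p q. ((\<lambda>s. f s $ p $ q) has_vector_derivative f' p q) (at t within X)"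
  shows "(f has_vector_derivative (\<chi> p q. f' p q)) (at t within X)"
  by (intro has_vector_derivative_vec_componentwise assms)

lemma has_vector_derivative_poly_matrix:
  fixes w :: "'m::finite \<Rightarrow> 'n::finite \<Rightarrow> real poly"
  shows "((\<lambda>\<theta>. (\<chi> p q. poly (w p q) \<theta>) :: real^'n^'m) has_vector_derivative
     (\<chi> p q. poly (pderiv (w p q)) \<theta>)) (at \<theta> within X)"
  by (rule has_vector_derivative_matrix_componentwise)
    (simp add: has_real_derivative_iff_has_vector_derivative[symmetric]
      has_field_derivative_at_within poly_DERIV)

lemma bounded_bilinear_matrix_vector_mult:
  "bounded_bilinear ((*v) :: real^'n^'m \<Rightarrow> real^'n \<Rightarrow> real^'m)"
  unfolding bilinear_conv_bounded_bilinear[symmetric] bilinear_def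
  by (auto intro!: linearI simp: matrix_vector_mult_add_rdistrib scaleR_matrix_vector_assoc
      matrix_vector_mult_scaleR)

lemma inner_integral:
  fixes f :: "real \<Rightarrow> 'a::euclidean_space"
  assumes "f integrable_on X"
  shows "u \<bullet> integral X f = integral X (\<lambda>s. u \<bullet> f s)"
  using integral_linear[OF assms bounded_linear_inner_right[of u]] by (simp add: o_def)

lemma has_vector_derivative_quadratic_form:
  fixes x :: "real \<Rightarrow> real^'n"
  assumes P: "transpose P = P" and x: "(x has_vector_derivative x') (at t within X)"
  shows "((\<lambda>t. x t \<bullet> (P *v x t)) has_vector_derivative 2 * (x t \<bullet> (P *v x'))) (at t within X)"
proof -
  have "((\<lambda>t. x t \<bullet> (P *v x t)) has_vector_derivative (x t \<bullet> (P *v x') + x' \<bullet> (P *v x t)))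
      (at t within X)"
    by (intro bounded_bilinear.has_vector_derivative[OF bounded_bilinear_inner] x
        bounded_linear.has_vector_derivative[OF matrix_vector_mul_bounded_linear])
  moreover have "x' \<bullet> (P *v x t) = x t \<bullet> (P *v x')"
    using inner_transpose_matrix_vector[of x' P "x t"] P by simp
  ultimately show ?thesis by simp
qed

lemma continuous_on_shift:
  fixes x :: "real \<Rightarrow> 'a::topological_space"
  assumes "continuous_on UNIV x"
  shows "continuous_on X (\<lambda>\<theta>. x (t + \<theta>))"
  by (rule continuous_on_compose2[OF assms]) (auto intro!: continuous_intros)

lemma has_vector_derivative_cross_term:
  fixes x :: "real \<Rightarrow> real^'n" and H H' :: "real \<Rightarrow> real^'n^'n"
  assumes ab: "a < b"
    and H: "\<And>\<theta>. \<theta> \<in> {a..b} \<Longrightarrow> (H has_vector_derivative H' \<theta>) (at \<theta> within {a..b})"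
    and H': "continuous_on {a..b} H'"
    and x: "continuous_on UNIV x" and dx: "(x has_vector_derivative x') (at t within X)"
  shows "((\<lambda>t. integral {a..b} (\<lambda>\<theta>. x t \<bullet> (H \<theta> *v x (t + \<theta>)))) has_vector_derivative
      integral {a..b} (\<lambda>\<theta>. x' \<bullet> (H \<theta> *v x (t + \<theta>)))
      + x t \<bullet> (H b *v x (t + b)) - x t \<bullet> (H a *v x (t + a))
      - integral {a..b} (\<lambda>\<theta>. x t \<bullet> (H' \<theta> *v x (t + \<theta>)))) (at t within X)"
proof -
  note bil = bounded_bilinear_matrix_vector_mult
  have Hc: "continuous_on {a..b} H"
    using H by (meson continuous_on_eq_continuous_within has_vector_derivative_continuous)
  have int: "(\<lambda>\<theta>. G \<theta> *v x (s + \<theta>)) integrable_on {a..b}"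
    if "continuous_on {a..b} G" for G :: "real \<Rightarrow> real^'n^'n" and s
    by (intro integrable_continuous_interval bounded_bilinear.continuous_on[OF bil] that
        continuous_on_shift x)
  have "((\<lambda>t. x t \<bullet> integral {a..b} (\<lambda>\<theta>. H \<theta> *v x (t + \<theta>))) has_vector_derivative
      (x t \<bullet> (H b *v x (t + b) - H a *v x (t + a) - integral {a..b} (\<lambda>\<theta>. H' \<theta> *v x (t + \<theta>)))
       + x' \<bullet> integral {a..b} (\<lambda>\<theta>. H \<theta> *v x (t + \<theta>)))) (at t within X)"
    by (intro bounded_bilinear.has_vector_derivative[OF bounded_bilinear_inner] dx
        has_vector_derivative_sliding_integral[OF bil ab H H' x])
  then show ?thesis
    unfolding inner_diff_right inner_integral[OF int[OF Hc]] inner_integral[OF int[OF H']]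
    by (rule has_vector_derivative_eq_rhs) simp
qed

text \<open>
  The quadratic form is the Frobenius inner product of \<open>H \<theta>\<close> with the outer product of the
  history value with itself, which is again a sliding integral.
\<close>

lemma has_vector_derivative_quadratic_term:
  fixes x :: "real \<Rightarrow> real^'n" and H H' :: "real \<Rightarrow> real^'n^'n"
  assumes ab: "a < b"
    and H: "\<And>\<theta>. \<theta> \<in> {a..b} \<Longrightarrow> (H has_vector_derivative H' \<theta>) (at \<theta> within {a..b})"
    and H': "continuous_on {a..b} H'"
    and x: "continuous_on UNIV x"
  shows "((\<lambda>t. integral {a..b} (\<lambda>\<theta>. x (t + \<theta>) \<bullet> (H \<theta> *v x (t + \<theta>)))) has_vector_derivative
      x (t + b) \<bullet> (H b *v x (t + b)) - x (t + a) \<bullet> (H a *v x (t + a))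
      - integral {a..b} (\<lambda>\<theta>. x (t + \<theta>) \<bullet> (H' \<theta> *v x (t + \<theta>)))) (at t within X)"
proof -
  have outer: "u \<bullet> (G *v u) = G \<bullet> (\<chi> p q. u $ p * u $ q)" for G :: "real^'n^'n" and u
    unfolding inner_matrix_vector_entries by (simp add: inner_vec_def mult_ac)
  have "continuous_on UNIV (\<lambda>s. (\<chi> p q. x s $ p * x s $ q) :: real^'n^'n)"
    by (intro continuous_on_vec_lambda continuous_intros x)
  from has_vector_derivative_sliding_integral[OF bounded_bilinear_inner ab H H' this, of t X]
  show ?thesis unfolding outer .
qed

text \<open>
  The product rule applied to the moments of a separated kernel.  The boundary terms of the two
  sliding integrals are the first four terms, and the interior terms assemble into the kernel
  \<open>L = \<partial>N/\<partial>\<theta> + \<partial>N/\<partial>\<omega>\<close>, which is itself separated.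
\<close>

lemma has_vector_derivative_double_integral:
  fixes x :: "real \<Rightarrow> real^'n" and N L :: "real \<Rightarrow> real \<Rightarrow> real^'n^'n"
    and f f' g g' :: "'r \<Rightarrow> real \<Rightarrow> real"
  assumes ab: "a < b" "a' < b'"
    and N: "\<And>\<theta> \<omega> p q. \<theta> \<in> {a..b} \<Longrightarrow> \<omega> \<in> {a'..b'} \<Longrightarrow>
      N \<theta> \<omega> $ p $ q = (\<Sum>r\<in>\<rho>. c p q r * f r \<theta> * g r \<omega>)"
    and L: "\<And>\<theta> \<omega> p q. \<theta> \<in> {a..b} \<Longrightarrow> \<omega> \<in> {a'..b'} \<Longrightarrow>
      L \<theta> \<omega> $ p $ q = (\<Sum>r\<in>\<rho>. c p q r * (f' r \<theta> * g r \<omega> + f r \<theta> * g' r \<omega>))"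
    and df: "\<And>r \<theta>. \<theta> \<in> {a..b} \<Longrightarrow> (f r has_vector_derivative f' r \<theta>) (at \<theta> within {a..b})"
    and dg: "\<And>r \<theta>. \<theta> \<in> {a'..b'} \<Longrightarrow> (g r has_vector_derivative g' r \<theta>) (at \<theta> within {a'..b'})"
    and cf': "\<And>r. continuous_on {a..b} (f' r)" and cg': "\<And>r. continuous_on {a'..b'} (g' r)"
    and fin: "finite \<rho>" and x: "continuous_on UNIV x"
  shows "((\<lambda>t. integral {a..b} (\<lambda>\<theta>. integral {a'..b'} (\<lambda>\<omega>. x (t + \<theta>) \<bullet> (N \<theta> \<omega> *v x (t + \<omega>)))))
    has_vector_derivative
      integral {a'..b'} (\<lambda>\<omega>. x (t + b) \<bullet> (N b \<omega> *v x (t + \<omega>)))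
      - integral {a'..b'} (\<lambda>\<omega>. x (t + a) \<bullet> (N a \<omega> *v x (t + \<omega>)))
      + integral {a..b} (\<lambda>\<theta>. x (t + \<theta>) \<bullet> (N \<theta> b' *v x (t + b')))
      - integral {a..b} (\<lambda>\<theta>. x (t + \<theta>) \<bullet> (N \<theta> a' *v x (t + a')))
      - integral {a..b} (\<lambda>\<theta>. integral {a'..b'} (\<lambda>\<omega>. x (t + \<theta>) \<bullet> (L \<theta> \<omega> *v x (t + \<omega>)))))
    (at t within X)"
proof -
  have cf: "continuous_on {a..b} (f r)" and cg: "continuous_on {a'..b'} (g r)" for r
    using df dg by (meson continuous_on_eq_continuous_within has_vector_derivative_continuous)+
  note xs = continuous_on_shift[OF x]
  define U where "U r p t = integral {a..b} (\<lambda>\<theta>. f r \<theta> * x (t + \<theta>) $ p)" for r p t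
  define W where "W r q t = integral {a'..b'} (\<lambda>\<omega>. g r \<omega> * x (t + \<omega>) $ q)" for r q t
  define Uh where "Uh r p = integral {a..b} (\<lambda>\<theta>. f' r \<theta> * x (t + \<theta>) $ p)" for r p
  define Wh where "Wh r q = integral {a'..b'} (\<lambda>\<omega>. g' r \<omega> * x (t + \<omega>) $ q)" for r q
  define Ud where "Ud r p = f r b * x (t + b) $ p - f r a * x (t + a) $ p - Uh r p" for r p
  define Wd where "Wd r q = g r b' * x (t + b') $ q - g r a' * x (t + a') $ q - Wh r q" for r q
  have fi: "((\<lambda>\<theta>. f r \<theta> * x (t + \<theta>) $ p) has_integral U r p t) {a..b}" for r p
    unfolding U_def
    by (intro integrable_integral integrable_continuous_interval continuous_intros cf xs)
  have gi: "((\<lambda>\<omega>. g r \<omega> * x (t + \<omega>) $ q) has_integral W r q t) {a'..b'}" for r q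
    unfolding W_def
    by (intro integrable_integral integrable_continuous_interval continuous_intros cg xs)
  have right: "integral {a'..b'} (\<lambda>\<omega>. u \<bullet> (N \<theta> \<omega> *v x (t + \<omega>))) =
      (\<Sum>p\<in>UNIV. \<Sum>q\<in>UNIV. \<Sum>r\<in>\<rho>. c p q r * (f r \<theta> * u $ p * W r q t))"
    if \<theta>: "\<theta> \<in> {a..b}" for \<theta> u
  proof -
    have "integral {a'..b'} (\<lambda>\<omega>. u \<bullet> (N \<theta> \<omega> *v x (t + \<omega>))) = integral {a'..b'} (\<lambda>\<omega>.
        \<Sum>p\<in>UNIV. \<Sum>q\<in>UNIV. \<Sum>r\<in>\<rho>. (c p q r * f r \<theta> * u $ p) * (g r \<omega> * x (t + \<omega>) $ q))"
      unfolding inner_matrix_vector_entries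
      by (intro integral_cong sum.cong refl)
        (simp add: N[OF \<theta>] sum_distrib_left sum_distrib_right mult_ac)
    also have "\<dots> = (\<Sum>p\<in>UNIV. \<Sum>q\<in>UNIV. \<Sum>r\<in>\<rho>. (c p q r * f r \<theta> * u $ p) * W r q t)"
      by (intro integral_unique has_integral_sum has_integral_mult_right gi fin finite)
    finally show ?thesis by (simp add: mult_ac)
  qed
  have left: "integral {a..b} (\<lambda>\<theta>. x (t + \<theta>) \<bullet> (N \<theta> \<omega> *v v)) =
      (\<Sum>p\<in>UNIV. \<Sum>q\<in>UNIV. \<Sum>r\<in>\<rho>. c p q r * (U r p t * (g r \<omega> * v $ q)))"
    if \<omega>: "\<omega> \<in> {a'..b'}" for \<omega> v
  proof -
    have "integral {a..b} (\<lambda>\<theta>. x (t + \<theta>) \<bullet> (N \<theta> \<omega> *v v)) = integral {a..b} (\<lambda>\<theta>.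
        \<Sum>p\<in>UNIV. \<Sum>q\<in>UNIV. \<Sum>r\<in>\<rho>. (c p q r * g r \<omega> * v $ q) * (f r \<theta> * x (t + \<theta>) $ p))"
      unfolding inner_matrix_vector_entries
      by (intro integral_cong sum.cong refl)
        (simp add: N[OF _ \<omega>] sum_distrib_left sum_distrib_right mult_ac)
    also have "\<dots> = (\<Sum>p\<in>UNIV. \<Sum>q\<in>UNIV. \<Sum>r\<in>\<rho>. (c p q r * g r \<omega> * v $ q) * U r p t)"
      by (intro integral_unique has_integral_sum has_integral_mult_right fi fin finite)
    finally show ?thesis by (simp add: mult_ac)
  qed
  have dU: "((\<lambda>t. U r p t) has_vector_derivative Ud r p) (at t within X)" for r p
    unfolding U_def Ud_def Uh_def
    by (rule has_vector_derivative_sliding_integral[OF bounded_bilinear_mult ab(1) df cf'])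
      (assumption, intro continuous_intros x)
  have dW: "((\<lambda>t. W r q t) has_vector_derivative Wd r q) (at t within X)" for r q
    unfolding W_def Wd_def Wh_def
    by (rule has_vector_derivative_sliding_integral[OF bounded_bilinear_mult ab(2) dg cg'])
      (assumption, intro continuous_intros x)
  have double: "integral {a..b} (\<lambda>\<theta>. integral {a'..b'} (\<lambda>\<omega>. x (t + \<theta>) \<bullet> (N \<theta> \<omega> *v x (t + \<omega>)))) =
      (\<Sum>p\<in>UNIV. \<Sum>q\<in>UNIV. \<Sum>r\<in>\<rho>. c p q r * (U r p t * W r q t))" for t
    unfolding U_def W_def mult.assoc[symmetric]
    by (rule separable_double_integral[OF N xs xs cf cg fin])
  have doubleL: "integral {a..b} (\<lambda>\<theta>. integral {a'..b'} (\<lambda>\<omega>. x (t + \<theta>) \<bullet> (L \<theta> \<omega> *v x (t + \<omega>)))) =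
      (\<Sum>p\<in>UNIV. \<Sum>q\<in>UNIV. \<Sum>r\<in>\<rho>. c p q r * (Uh r p * W r q t + U r p t * Wh r q))"
  proof -
    \<comment> \<open>The Boolean component of the index selects which of the two factors is differentiated.\<close>
    have "integral {a..b} (\<lambda>\<theta>. integral {a'..b'} (\<lambda>\<omega>. x (t + \<theta>) \<bullet> (L \<theta> \<omega> *v x (t + \<omega>)))) =
      (\<Sum>p\<in>UNIV. \<Sum>q\<in>UNIV. \<Sum>r\<in>\<rho> \<times> UNIV. c p q (fst r)
         * integral {a..b} (\<lambda>\<theta>. (if snd r then f' (fst r) \<theta> else f (fst r) \<theta>) * x (t + \<theta>) $ p)
         * integral {a'..b'} (\<lambda>\<omega>. (if snd r then g (fst r) \<omega> else g' (fst r) \<omega>) * x (t + \<omega>) $ q))"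
    proof (rule separable_double_integral)
      fix \<theta> \<omega> p q assume "\<theta> \<in> {a..b}" "\<omega> \<in> {a'..b'}"
      then show "L \<theta> \<omega> $ p $ q = (\<Sum>r\<in>\<rho> \<times> UNIV. c p q (fst r)
          * (if snd r then f' (fst r) \<theta> else f (fst r) \<theta>) * (if snd r then g (fst r) \<omega> else g' (fst r) \<omega>))"
        by (simp add: L sum.cartesian_product' UNIV_bool algebra_simps)
    next
      show "continuous_on {a..b} (\<lambda>\<theta>. if snd r then f' (fst r) \<theta> else f (fst r) \<theta>)" for r :: "'r \<times> bool"
        using cf cf' by (cases "snd r") auto
      show "continuous_on {a'..b'} (\<lambda>\<theta>. if snd r then g (fst r) \<theta> else g' (fst r) \<theta>)" for r :: "'r \<times> bool"
        using cg cg' by (cases "snd r") auto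
    qed (use xs fin in auto)
    also have "\<dots> = (\<Sum>p\<in>UNIV. \<Sum>q\<in>UNIV. \<Sum>r\<in>\<rho>. c p q r * (Uh r p * W r q t + U r p t * Wh r q))"
      unfolding sum.cartesian_product' fst_conv snd_conv
      by (intro sum.cong refl) (simp add: UNIV_bool U_def W_def Uh_def Wh_def algebra_simps)
    finally show ?thesis .
  qed
  have "((\<lambda>t. \<Sum>p\<in>UNIV. \<Sum>q\<in>UNIV. \<Sum>r\<in>\<rho>. c p q r * (U r p t * W r q t)) has_vector_derivative
      (\<Sum>p\<in>UNIV. \<Sum>q\<in>UNIV. \<Sum>r\<in>\<rho>. c p q r * (U r p t * Wd r q + Ud r p * W r q t))) (at t within X)"
    by (intro has_vector_derivative_sum has_vector_derivative_mult_right has_vector_derivative_mult dU dW)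
  also have "(\<Sum>p\<in>UNIV. \<Sum>q\<in>UNIV. \<Sum>r\<in>\<rho>. c p q r * (U r p t * Wd r q + Ud r p * W r q t)) =
      integral {a'..b'} (\<lambda>\<omega>. x (t + b) \<bullet> (N b \<omega> *v x (t + \<omega>)))
      - integral {a'..b'} (\<lambda>\<omega>. x (t + a) \<bullet> (N a \<omega> *v x (t + \<omega>)))
      + integral {a..b} (\<lambda>\<theta>. x (t + \<theta>) \<bullet> (N \<theta> b' *v x (t + b')))
      - integral {a..b} (\<lambda>\<theta>. x (t + \<theta>) \<bullet> (N \<theta> a' *v x (t + a')))
      - integral {a..b} (\<lambda>\<theta>. integral {a'..b'} (\<lambda>\<omega>. x (t + \<theta>) \<bullet> (L \<theta> \<omega> *v x (t + \<omega>))))"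
  proof -
    have mem: "a \<in> {a..b}" "b \<in> {a..b}" "a' \<in> {a'..b'}" "b' \<in> {a'..b'}" using ab by auto
    show ?thesis
      unfolding doubleL right[OF mem(1)] right[OF mem(2)] left[OF mem(3)] left[OF mem(4)]
        sum.distrib[symmetric] sum_subtractf[symmetric]
      by (intro sum.cong refl) (simp add: Ud_def Wd_def algebra_simps)
  qed
  finally show ?thesis unfolding double .
qed

section \<open>Smoothness of the data on the delay intervals\<close>

lemma pos_families_polynomial_block:
  fixes N :: "nat \<Rightarrow> real \<Rightarrow> nat \<Rightarrow> nat \<Rightarrow> real^'n^'n"
  assumes N: "N \<in> pos_families m \<tau> K d" and i: "i \<in> {1..K}" and ab: "a \<in> {1..m+1}" "b \<in> {1..m+1}"
  shows "\<exists>w. \<forall>\<theta>\<in>delay_ivl \<tau> i. N i \<theta> a b = (\<chi> p q. poly (w p q) \<theta>)"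
proof -
  obtain W where W: "\<forall>i\<in>{1..K}. \<forall>\<theta>\<in>delay_ivl \<tau> i. \<forall>x\<in>block_idx (m + 1). \<forall>y\<in>block_idx (m + 1).
        block_entry (N i \<theta>) x y = poly (W i x y) \<theta>"
    using N[unfolded pos_families_def mem_Collect_eq] by (elim exE conjE) (rule that)
  have "N i \<theta> a b $ p $ q = poly (W i (a, p) (b, q)) \<theta>" if "\<theta> \<in> delay_ivl \<tau> i" for \<theta> p q
    using W[rule_format, OF i that, of "(a, p)" "(b, q)"] ab by (simp add: block_idx_def block_entry_def)
  then show ?thesis
    by (intro exI[of _ "\<lambda>p q. W i (a, p) (b, q)"]) (simp add: vec_eq_iff)
qed

text \<open>
  On \<open>I\<^sub>i\<close> the data are polynomial up to the factor \<open>k\<close> (which is \<open>\<tau>\<^sub>K\<close> for the entries of \<open>M\<close>).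
  Because \<open>I\<^sub>i\<close> is nondegenerate, the one-sided derivative at its end points is unique and
  agrees with that of the polynomial.
\<close>

lemma ivl_deriv_polynomial:
  fixes X :: "nat \<Rightarrow> real \<Rightarrow> real^'n^'n"
  assumes i: "\<tau> (i - 1) < \<tau> i" and k: "k \<noteq> 0"
    and X: "\<And>\<theta>. \<theta> \<in> delay_ivl \<tau> i \<Longrightarrow> k *\<^sub>R X i \<theta> = (\<chi> p q. poly (w p q) \<theta>)"
  shows "\<theta> \<in> delay_ivl \<tau> i \<Longrightarrow>
      (X i has_vector_derivative ivl_deriv \<tau> X i \<theta>) (at \<theta> within delay_ivl \<tau> i)"
    and "continuous_on (delay_ivl \<tau> i) (ivl_deriv \<tau> X i)"
proof -
  define X' where "X' \<theta> = (1 / k) *\<^sub>R ((\<chi> p q. poly (pderiv (w p q)) \<theta>) :: real^'n^'n)" for \<theta>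
  have der: "(X i has_vector_derivative X' \<theta>) (at \<theta> within delay_ivl \<tau> i)"
    if \<theta>: "\<theta> \<in> delay_ivl \<tau> i" for \<theta>
  proof (rule has_vector_derivative_transform[OF \<theta>])
    show "X i u = (1 / k) *\<^sub>R (\<chi> p q. poly (w p q) u)" if "u \<in> delay_ivl \<tau> i" for u
      using X[OF that, symmetric] k by simp
    show "((\<lambda>u. (1 / k) *\<^sub>R ((\<chi> p q. poly (w p q) u) :: real^'n^'n)) has_vector_derivative X' \<theta>)
        (at \<theta> within delay_ivl \<tau> i)"
      unfolding X'_def
      by (intro bounded_linear.has_vector_derivative[OF bounded_linear_scaleR_right]
          has_vector_derivative_poly_matrix)
  qed
  have eq: "ivl_deriv \<tau> X i \<theta> = X' \<theta>" if \<theta>: "\<theta> \<in> delay_ivl \<tau> i" for \<theta>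
    using der[OF \<theta>] \<theta> i unfolding ivl_deriv_def delay_ivl_def
    by (intro vector_derivative_within_closed_interval) auto
  show "\<theta> \<in> delay_ivl \<tau> i \<Longrightarrow>
      (X i has_vector_derivative ivl_deriv \<tau> X i \<theta>) (at \<theta> within delay_ivl \<tau> i)"
    using der eq by simp
  have "continuous_on (delay_ivl \<tau> i) X'"
    unfolding X'_def by (intro continuous_intros continuous_on_vec_lambda)
  then show "continuous_on (delay_ivl \<tau> i) (ivl_deriv \<tau> X i)"
    using eq by (simp cong: continuous_on_cong)
qed

definition seg_monomial_deriv :: "(nat \<Rightarrow> real) \<Rightarrow> nat \<Rightarrow> nat \<Rightarrow> nat \<Rightarrow> real \<Rightarrow> real" where
  "seg_monomial_deriv \<tau> K i k \<theta> =
     of_nat k * seg_scale \<tau> K i \<theta> ^ (k - 1) * (\<tau> K / (\<tau> i - \<tau> (i - 1)))"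

lemma has_vector_derivative_seg_monomial:
  "((\<lambda>\<theta>. seg_scale \<tau> K i \<theta> ^ k) has_vector_derivative seg_monomial_deriv \<tau> K i k \<theta>) (at \<theta> within X)"
  unfolding has_real_derivative_iff_has_vector_derivative[symmetric] seg_monomial_deriv_def seg_scale_def
  by (rule derivative_eq_intros refl | simp)+

lemma continuous_on_seg_monomial_deriv: "continuous_on X (seg_monomial_deriv \<tau> K i k)"
  unfolding seg_monomial_deriv_def by (intro continuous_intros)

lemma L_fam_entries:
  fixes R :: "nat \<Rightarrow> nat \<Rightarrow> real \<Rightarrow> real \<Rightarrow> real^'n^'n"
  assumes ij: "\<tau> (i - 1) < \<tau> i" "\<tau> (j - 1) < \<tau> j" 
    and \<theta>: "\<theta> \<in> delay_ivl \<tau> i" and \<omega>: "\<omega> \<in> delay_ivl \<tau> j"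
    and R: "\<And>\<theta> \<omega> p q. \<theta> \<in> delay_ivl \<tau> i \<Longrightarrow> \<omega> \<in> delay_ivl \<tau> j \<Longrightarrow>
      R i j \<theta> \<omega> $ p $ q = (\<Sum>r\<in>\<rho>. c p q r * seg_scale \<tau> K i \<theta> ^ fst r * seg_scale \<tau> K j \<omega> ^ snd r)"
  shows "L_fam \<tau> R i j \<theta> \<omega> $ p $ q = (\<Sum>r\<in>\<rho>. c p q r *
      (seg_monomial_deriv \<tau> K i (fst r) \<theta> * seg_scale \<tau> K j \<omega> ^ snd r
        + seg_scale \<tau> K i \<theta> ^ fst r * seg_monomial_deriv \<tau> K j (snd r) \<omega>))"
proof -
  have 1: "((\<lambda>s. R i j s \<omega>) has_vector_derivative (\<chi> p q. \<Sum>r\<in>\<rho>. c p q r *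
      seg_monomial_deriv \<tau> K i (fst r) \<theta> * seg_scale \<tau> K j \<omega> ^ snd r)) (at \<theta> within delay_ivl \<tau> i)"
  proof (rule has_vector_derivative_transform[OF \<theta>])
    show "((\<lambda>s. (\<chi> p q. \<Sum>r\<in>\<rho>. c p q r * seg_scale \<tau> K i s ^ fst r * seg_scale \<tau> K j \<omega> ^ snd r) :: real^'n^'n)
      has_vector_derivative (\<chi> p q. \<Sum>r\<in>\<rho>. c p q r *
      seg_monomial_deriv \<tau> K i (fst r) \<theta> * seg_scale \<tau> K j \<omega> ^ snd r)) (at \<theta> within delay_ivl \<tau> i)"
      by (rule has_vector_derivative_matrix_componentwise, unfold vec_lambda_beta)
        (intro has_vector_derivative_sum has_vector_derivative_mult_left has_vector_derivative_mult_right
          has_vector_derivative_seg_monomial)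
  qed (use \<omega> R in \<open>simp add: vec_eq_iff\<close>)
  have 2: "((\<lambda>s. R i j \<theta> s) has_vector_derivative (\<chi> p q. \<Sum>r\<in>\<rho>. c p q r *
      seg_scale \<tau> K i \<theta> ^ fst r * seg_monomial_deriv \<tau> K j (snd r) \<omega>)) (at \<omega> within delay_ivl \<tau> j)"
  proof (rule has_vector_derivative_transform[OF \<omega>])
    show "((\<lambda>s. (\<chi> p q. \<Sum>r\<in>\<rho>. c p q r * seg_scale \<tau> K i \<theta> ^ fst r * seg_scale \<tau> K j s ^ snd r) :: real^'n^'n)
      has_vector_derivative (\<chi> p q. \<Sum>r\<in>\<rho>. c p q r *
      seg_scale \<tau> K i \<theta> ^ fst r * seg_monomial_deriv \<tau> K j (snd r) \<omega>)) (at \<omega> within delay_ivl \<tau> j)"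
      by (rule has_vector_derivative_matrix_componentwise, unfold vec_lambda_beta)
        (intro has_vector_derivative_sum has_vector_derivative_mult_right
          has_vector_derivative_seg_monomial)
  qed (use \<theta> R in \<open>simp add: vec_eq_iff\<close>)
  have "vector_derivative (\<lambda>s. R i j s \<omega>) (at \<theta> within delay_ivl \<tau> i) =
      (\<chi> p q. \<Sum>r\<in>\<rho>. c p q r * seg_monomial_deriv \<tau> K i (fst r) \<theta> * seg_scale \<tau> K j \<omega> ^ snd r)"
    using 1 \<theta> ij(1) unfolding delay_ivl_def
    by (intro vector_derivative_within_closed_interval) auto
  moreover have "vector_derivative (\<lambda>s. R i j \<theta> s) (at \<omega> within delay_ivl \<tau> j) =
      (\<chi> p q. \<Sum>r\<in>\<rho>. c p q r * seg_scale \<tau> K i \<theta> ^ fst r * seg_monomial_deriv \<tau> K j (snd r) \<omega>)"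
    using 2 \<omega> ij(2) unfolding delay_ivl_def
    by (intro vector_derivative_within_closed_interval) auto
  ultimately show ?thesis
    by (simp add: L_fam_def sum.distrib[symmetric] algebra_simps)
qed

section \<open>The derivative as a quadratic form\<close>

text \<open>
  In the derivative of the functional each interior point \<open>-\<tau>\<^sub>a\<close> is met twice, as the left end of
  one interval and the right end of the next; \<open>E\<close> and \<open>F\<close> list the same terms by delay.  The two
  arrangements differ by this index shift, with the outermost delay contributing no \<open>f\<close>-term.
\<close>

lemma sum_shifted_difference:
  fixes f g :: "nat \<Rightarrow> real"
  assumes "K \<ge> 1"
  shows "(\<Sum>i=1..K. f i - g i) = f 1 + (\<Sum>a=2..K+1. (if a \<le> K then f a else 0) - g (a - 1))"
proof -
  have "(\<Sum>a=2..K+1. if a \<le> K then f a else 0) = (\<Sum>a=2..K. f a)"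
    by (intro sum.mono_neutral_cong_right) auto
  moreover have "(\<Sum>a=2..K+1. g (a - 1)) = (\<Sum>i=1..K. g i)"
    using sum.shift_bounds_cl_nat_ivl[of "\<lambda>a. g (a - 1)" 1 1 K] by (simp add: numeral_2_eq_2)
  moreover have "(\<Sum>i=1..K. f i) = f 1 + (\<Sum>a=2..K. f a)"
    using assms by (simp add: sum.atLeast_Suc_atMost numeral_2_eq_2)
  ultimately show ?thesis by (simp add: sum_subtractf)
qed

lemma M_quadratic_form:
  fixes P :: "real^'n^'n" and x y :: "real^'n"
  defines "w \<equiv> \<lambda>a. if a \<le> (1::nat) then x else y"
  shows "(\<Sum>a=1..1+1. \<Sum>b=1..1+1. w a \<bullet> (M_fam K \<tau> P \<eta> Q S i \<theta> a b *v w b))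
    = x \<bullet> (P *v x) - \<eta> * (x \<bullet> x) + \<tau> K * (2 * (x \<bullet> (Q i \<theta> *v y)) + y \<bullet> (S i \<theta> *v y))"
  unfolding M_fam_def bordered_quadratic_form
  by (simp add: w_def matrix_vector_mult_diff_rdistrib inner_diff_right distrib_left
      scaleR_matrix_vector_assoc[symmetric])

text \<open>
  With \<open>z a = x(t - \<tau>\<^sub>a\<^sub>-\<^sub>1)\<close> the vector \<open>z'\<close> is \<open>x'(t)\<close>.  The right-hand side is
  grouped by interval, as the derivative of the functional delivers it; \<open>E\<close> groups by delay.
\<close>

lemma E_quadratic_form:
  fixes P :: "real^'n^'n" and A :: "nat \<Rightarrow> real^'n^'n" and z :: "nat \<Rightarrow> real^'n"
  assumes K: "K \<ge> 1" and \<tau>0: "\<tau> 0 = 0" and P: "transpose P = P"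
  defines "z' \<equiv> (\<Sum>a=1..K+1. A (a - 1) *v z a)"
  shows "(\<Sum>a=1..K+1. \<Sum>b=1..K+1. z a \<bullet> (E_mat K \<tau> A P \<eta> Q S a b *v z b))
    = 2 * (z 1 \<bullet> (P *v z')) + \<eta> * (z 1 \<bullet> z 1)
      + (\<Sum>i=1..K. 2 * (z 1 \<bullet> (Q i (- \<tau> (i - 1)) *v z i) - z 1 \<bullet> (Q i (- \<tau> i) *v z (i + 1)))
          + (z i \<bullet> (S i (- \<tau> (i - 1)) *v z i) - z (i + 1) \<bullet> (S i (- \<tau> i) *v z (i + 1))))"
proof -
  define E where "E = E_mat K \<tau> A P \<eta> Q S"
  define fQ where "fQ i = z 1 \<bullet> (Q i (- \<tau> (i - 1)) *v z i)" for i
  define gQ where "gQ i = z 1 \<bullet> (Q i (- \<tau> i) *v z (i + 1))" for i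
  define fS where "fS i = z i \<bullet> (S i (- \<tau> (i - 1)) *v z i)" for i
  define gS where "gS i = z (i + 1) \<bullet> (S i (- \<tau> i) *v z (i + 1))" for i
  define pa where "pa a = z 1 \<bullet> (P *v (A (a - 1) *v z a))" for a
  have split: "(\<Sum>a=1..K+1. h a) = h 1 + (\<Sum>a=2..K+1. h a)" for h :: "nat \<Rightarrow> real"
    by (simp add: sum.atLeast_Suc_atMost numeral_2_eq_2)
  have row: "z 1 \<bullet> (E 1 b *v z b) = pa b + ((if b \<le> K then fQ b else 0) - gQ (b - 1))"
    if "b \<in> {2..K+1}" for b
    using that by (cases "b \<le> K")
      (auto simp: E_def E_mat_def E_row1_def pa_def fQ_def gQ_def matrix_vector_mult_diff_rdistrib
        matrix_vector_mult_add_rdistrib inner_diff_right inner_add_right matrix_vector_mul_assoc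
        le_Suc_eq)
  have col: "z b \<bullet> (E b 1 *v z 1) = z 1 \<bullet> (E 1 b *v z b)" if "b \<in> {2..K+1}" for b
    using that by (simp add: E_def E_mat_def inner_transpose_matrix_vector del: transpose_matrix_vector)
  have diag: "(\<Sum>b=2..K+1. z a \<bullet> (E a b *v z b)) = (if a \<le> K then fS a else 0) - gS (a - 1)"
    if a: "a \<in> {2..K+1}" for a
  proof -
    have "(\<Sum>b=2..K+1. z a \<bullet> (E a b *v z b)) = (\<Sum>b=2..K+1. if a = b then z a \<bullet> (E a a *v z a) else 0)"
      using a by (intro sum.cong refl) (auto simp: E_def E_mat_def)
    also have "\<dots> = z a \<bullet> (E a a *v z a)" using a by simp
    also have "\<dots> = (if a \<le> K then fS a else 0) - gS (a - 1)"
      using a by (auto simp: E_def E_mat_def fS_def gS_def matrix_vector_mult_diff_rdistrib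
          inner_diff_right matrix_vector_mult_minus_left le_Suc_eq)
    finally show ?thesis .
  qed
  have corner: "z 1 \<bullet> (E 1 1 *v z 1) = 2 * pa 1 + 2 * fQ 1 + fS 1 + \<eta> * (z 1 \<bullet> z 1)"
  proof -
    have "z 1 \<bullet> ((transpose (A 0) ** P) *v z 1) = z 1 \<bullet> (P *v (A 0 *v z 1))"
      by (metis P inner_transpose_matrix_mult inner_transpose_matrix_vector)
    moreover have "z 1 \<bullet> (transpose (Q 1 0) *v z 1) = z 1 \<bullet> (Q 1 0 *v z 1)"
      by (rule inner_transpose_matrix_vector)
    ultimately show ?thesis
      by (simp add: E_def E_mat_def pa_def fQ_def fS_def \<tau>0 matrix_vector_mult_add_rdistrib
          inner_add_right matrix_vector_mul_assoc[symmetric] scaleR_matrix_vector_assoc[symmetric]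
          del: transpose_matrix_vector)
  qed
  have pa: "z 1 \<bullet> (P *v z') = pa 1 + (\<Sum>a=2..K+1. pa a)"
    unfolding z'_def pa_def
    by (simp only: linear_sum[OF matrix_vector_mul_linear] inner_sum_right split)
  have "(\<Sum>a=1..K+1. \<Sum>b=1..K+1. z a \<bullet> (E a b *v z b)) =
      z 1 \<bullet> (E 1 1 *v z 1) + (\<Sum>b=2..K+1. z 1 \<bullet> (E 1 b *v z b))
      + (\<Sum>a=2..K+1. z a \<bullet> (E a 1 *v z 1) + (\<Sum>b=2..K+1. z a \<bullet> (E a b *v z b)))"
    by (simp only: split)
  also have "\<dots> = z 1 \<bullet> (E 1 1 *v z 1)
      + 2 * (\<Sum>a=2..K+1. pa a + ((if a \<le> K then fQ a else 0) - gQ (a - 1)))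
      + (\<Sum>a=2..K+1. (if a \<le> K then fS a else 0) - gS (a - 1))"
    by (simp only: sum.distrib col row diag cong: sum.cong) simp
  also have "\<dots> = 2 * (z 1 \<bullet> (P *v z')) + \<eta> * (z 1 \<bullet> z 1)
      + (2 * (\<Sum>i=1..K. fQ i - gQ i) + (\<Sum>i=1..K. fS i - gS i))"
    unfolding corner pa sum.distrib sum_shifted_difference[OF K] by simp
  finally show ?thesis
    unfolding E_def fQ_def gQ_def fS_def gS_def by (simp only: sum.distrib sum_distrib_left)
qed

lemma F_bilinear_form:
  fixes A :: "nat \<Rightarrow> real^'n^'n" and z :: "nat \<Rightarrow> real^'n" and y :: "real^'n"
  assumes K: "K \<ge> 1" and \<tau>0: "\<tau> 0 = 0"
  defines "z' \<equiv> (\<Sum>a=1..K+1. A (a - 1) *v z a)"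
  shows "(\<Sum>a=1..K+1. z a \<bullet> (F_col K \<tau> A Q R j \<theta> a *v y))
    = (\<Sum>i=1..K. z i \<bullet> (R i j (- \<tau> (i - 1)) \<theta> *v y) - z (i + 1) \<bullet> (R i j (- \<tau> i) \<theta> *v y))
      + z' \<bullet> (Q j \<theta> *v y) - z 1 \<bullet> (ivl_deriv \<tau> Q j \<theta> *v y)"
proof -
  define f where "f i = z i \<bullet> (R i j (- \<tau> (i - 1)) \<theta> *v y)" for i
  define g where "g i = z (i + 1) \<bullet> (R i j (- \<tau> i) \<theta> *v y)" for i
  define q where "q a = (A (a - 1) *v z a) \<bullet> (Q j \<theta> *v y)" for a
  have split: "(\<Sum>a=1..K+1. h a) = h 1 + (\<Sum>a=2..K+1. h a)" for h :: "nat \<Rightarrow> real"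
    by (simp add: sum.atLeast_Suc_atMost numeral_2_eq_2)
  have first: "z 1 \<bullet> (F_col K \<tau> A Q R j \<theta> 1 *v y) = f 1 + q 1 - z 1 \<bullet> (ivl_deriv \<tau> Q j \<theta> *v y)"
    by (simp add: F_col_def f_def q_def \<tau>0 matrix_vector_mult_diff_rdistrib inner_transpose_matrix_mult
        matrix_vector_mult_add_rdistrib inner_diff_right inner_add_right)
  have later: "z a \<bullet> (F_col K \<tau> A Q R j \<theta> a *v y) = q a + ((if a \<le> K then f a else 0) - g (a - 1))"
    if "a \<in> {2..K+1}" for a
    using that by (cases "a \<le> K")
      (auto simp: F_col_def f_def g_def q_def matrix_vector_mult_diff_rdistrib inner_transpose_matrix_mult
        matrix_vector_mult_add_rdistrib inner_diff_right inner_add_right le_Suc_eq)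
  have q: "z' \<bullet> (Q j \<theta> *v y) = q 1 + (\<Sum>a=2..K+1. q a)"
    unfolding z'_def q_def inner_sum_left split ..
  show ?thesis
    unfolding split first f_def[symmetric] g_def[symmetric] sum_shifted_difference[OF K] q
    using later by (simp add: sum.distrib)
qed

text \<open>
  The integrand of the derivative of the functional: the terms up to the sum over \<open>i\<close>
  are independent of \<open>\<theta>\<close>, and the factor \<open>\<tau>\<^sub>K\<close> in front of the rest compensates the
  averaging over intervals of total length \<open>\<tau>\<^sub>K\<close>.
\<close>

lemma D_quadratic_form:
  fixes P :: "real^'n^'n" and A :: "nat \<Rightarrow> real^'n^'n" and y :: "real^'n" and z :: "nat \<Rightarrow> real^'n"
  assumes K: "K \<ge> 1" and \<tau>0: "\<tau> 0 = 0" and P: "transpose P = P"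
  defines "w \<equiv> \<lambda>a. if a \<le> K + 1 then z a else y"
    and "z' \<equiv> (\<Sum>a=1..K+1. A (a - 1) *v z a)"
  shows "(\<Sum>a=1..K+1+1. \<Sum>b=1..K+1+1. w a \<bullet> (D_fam K \<tau> A P \<eta> Q S R j \<theta> a b *v w b))
    = 2 * (z 1 \<bullet> (P *v z')) + \<eta> * (z 1 \<bullet> z 1)
      + (\<Sum>i=1..K. 2 * (z 1 \<bullet> (Q i (- \<tau> (i - 1)) *v z i) - z 1 \<bullet> (Q i (- \<tau> i) *v z (i + 1)))
          + (z i \<bullet> (S i (- \<tau> (i - 1)) *v z i) - z (i + 1) \<bullet> (S i (- \<tau> i) *v z (i + 1))))
      + \<tau> K * (2 * ((\<Sum>i=1..K. z i \<bullet> (R i j (- \<tau> (i - 1)) \<theta> *v y) - z (i + 1) \<bullet> (R i j (- \<tau> i) \<theta> *v y))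
          + z' \<bullet> (Q j \<theta> *v y) - z 1 \<bullet> (ivl_deriv \<tau> Q j \<theta> *v y))
        - y \<bullet> (ivl_deriv \<tau> S j \<theta> *v y))"
proof -
  have E: "(\<Sum>a=1..K+1. \<Sum>b=1..K+1. w a \<bullet> (E_mat K \<tau> A P \<eta> Q S a b *v w b))
      = (\<Sum>a=1..K+1. \<Sum>b=1..K+1. z a \<bullet> (E_mat K \<tau> A P \<eta> Q S a b *v z b))"
    by (intro sum.cong refl) (simp add: w_def)
  have F: "(\<Sum>a=1..K+1. w a \<bullet> (\<tau> K *\<^sub>R F_col K \<tau> A Q R j \<theta> a *v w (K+1+1)))
      = \<tau> K * (\<Sum>a=1..K+1. z a \<bullet> (F_col K \<tau> A Q R j \<theta> a *v y))"
    unfolding sum_distrib_left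
    by (intro sum.cong refl) (simp add: w_def scaleR_matrix_vector_assoc[symmetric])
  have G: "w (K+1+1) \<bullet> (- (\<tau> K *\<^sub>R ivl_deriv \<tau> S j \<theta>) *v w (K+1+1))
      = - \<tau> K * (y \<bullet> (ivl_deriv \<tau> S j \<theta> *v y))"
    by (simp add: w_def matrix_vector_mult_minus_left scaleR_matrix_vector_assoc[symmetric])
  show ?thesis
    unfolding D_fam_def bordered_quadratic_form E F G
      E_quadratic_form[of K \<tau> P, OF K \<tau>0 P] F_bilinear_form[of K \<tau>, OF K \<tau>0] z'_def
    by (simp only: algebra_simps)
qed

section \<open>Lyapunov functions for delay equations\<close>

text \<open>
  The integral of a nonintegrable function is \<open>0\<close>, so the bound applies to iterated integrals
  directly, whatever the regularity of the inner one.
\<close>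

lemma integral_norm_le_length:
  fixes f :: "real \<Rightarrow> real"
  assumes "a \<le> b" "0 \<le> B" "\<And>s. s \<in> {a..b} \<Longrightarrow> \<bar>f s\<bar> \<le> B"
  shows "\<bar>integral {a..b} f\<bar> \<le> B * (b - a)"
proof (cases "f integrable_on {a..b}")
  case True
  then show ?thesis
    using has_integral_bound_real[OF assms(2) finite.emptyI integrable_integral[OF True]] assms by auto
next
  case False
  then show ?thesis using assms by (simp add: not_integrable_integral)
qed

lemma decrease_of_derivative_bound:
  fixes V :: "real \<Rightarrow> real"
  assumes dV: "\<And>t. t \<ge> 0 \<Longrightarrow> (V has_vector_derivative V' t) (at t within {0..})"
    and st: "0 \<le> s" "s \<le> t" and c: "\<And>u. u \<in> {s..t} \<Longrightarrow> V' u \<le> - c"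
  shows "V t \<le> V s - c * (t - s)"
proof -
  have cont: "continuous_on {0..} V"
    using dV by (meson atLeast_iff continuous_on_eq_continuous_within has_vector_derivative_continuous)
  have "V t + c * t \<le> V s + c * s"
  proof (rule DERIV_nonpos_imp_decreasing_open[OF st(2)])
    fix u assume u: "s < u" "u < t"
    have "(V has_vector_derivative V' u) (at u)"
      using dV[of u] u st(1) at_within_interior[of u "{0..}"] by simp
    then have "((\<lambda>u. V u + c * u) has_real_derivative V' u + c) (at u)"
      unfolding has_real_derivative_iff_has_vector_derivative[symmetric]
      by (auto intro!: derivative_eq_intros)
    then show "\<exists>y. ((\<lambda>u. V u + c * u) has_real_derivative y) (at u) \<and> y \<le> 0"
      using c[of u] u by (intro exI[of _ "V' u + c"]) auto
  next
    show "continuous_on {s..t} (\<lambda>u. V u + c * u)"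
      using st by (intro continuous_intros continuous_on_subset[OF cont]) auto
  qed
  then show ?thesis by (simp add: algebra_simps)
qed

text \<open>
  A form of Barbalat's lemma.  If \<open>norm (x t) \<ge> \<epsilon>\<close>, the Lipschitz bound keeps the norm above
  \<open>\<epsilon>/2\<close> for a time \<open>\<delta>\<close> that does not depend on \<open>t\<close>, during which \<open>V\<close> drops by a
  fixed \<open>\<kappa>\<close>.  Starting where \<open>V\<close> is within \<open>\<kappa>\<close> of its infimum, this is impossible.
\<close>

lemma tendsto_zero_of_dissipation:
  fixes V :: "real \<Rightarrow> real" and x :: "real \<Rightarrow> 'a::real_normed_vector"
  assumes dV: "\<And>t. t \<ge> 0 \<Longrightarrow> (V has_vector_derivative V' t) (at t within {0..})"
    and V': "\<And>t. t \<ge> 0 \<Longrightarrow> V' t \<le> - \<eta> * norm (x t) ^ 2" and \<eta>: "\<eta> > 0"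
    and V: "\<And>t. t \<ge> 0 \<Longrightarrow> 0 \<le> V t"
    and lip: "\<And>s t. 0 \<le> s \<Longrightarrow> s \<le> t \<Longrightarrow> norm (x t - x s) \<le> \<Lambda> * (t - s)"
  shows "(x \<longlongrightarrow> 0) at_top"
proof (rule ccontr)
  assume "\<not> (x \<longlongrightarrow> 0) at_top"
  then obtain \<epsilon> where \<epsilon>: "\<epsilon> > 0" and freq: "\<And>T. \<exists>t\<ge>T. \<epsilon> \<le> norm (x t)"
    unfolding tendsto_iff eventually_at_top_linorder by (auto simp: not_less)
  have \<Lambda>: "0 \<le> \<Lambda>" using lip[of 0 1] by (auto intro: order_trans[OF norm_ge_zero])
  define \<delta> where "\<delta> = \<epsilon> / (2 * (\<Lambda> + 1))"
  have \<delta>: "\<delta> > 0" using \<epsilon> \<Lambda> by (simp add: \<delta>_def)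
  have \<Lambda>\<delta>: "\<Lambda> * \<delta> \<le> \<epsilon> / 2" using \<epsilon> \<Lambda> by (simp add: \<delta>_def field_simps)
  define \<kappa> where "\<kappa> = \<eta> * (\<epsilon> / 2) ^ 2 * \<delta>"
  have \<kappa>: "\<kappa> > 0" using \<eta> \<epsilon> \<delta> by (simp add: \<kappa>_def)
  have bdd: "bdd_below (V ` {0..})" using V by (auto intro!: bdd_belowI[of _ 0])
  obtain T where T: "T \<ge> 0" "V T < (INF t\<in>{0..}. V t) + \<kappa>"
    using cINF_less_iff[of "{0..}" V "(INF t\<in>{0..}. V t) + \<kappa>"] bdd \<kappa> by auto
  obtain t where t: "t \<ge> T" "\<epsilon> \<le> norm (x t)" using freq by blast
  have "V t \<le> V T - 0 * (t - T)"
  proof (rule decrease_of_derivative_bound[OF dV T(1) t(1)])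
    fix u assume "u \<in> {T..t}"
    then have "V' u \<le> - \<eta> * norm (x u) ^ 2" using T(1) by (intro V') auto
    also have "\<dots> \<le> 0" using \<eta> by simp
    finally show "V' u \<le> - 0" by simp
  qed
  moreover have "V (t + \<delta>) \<le> V t - \<eta> * (\<epsilon> / 2) ^ 2 * (t + \<delta> - t)"
  proof (rule decrease_of_derivative_bound[OF dV])
    fix u assume u: "u \<in> {t..t + \<delta>}"
    have "norm (x u - x t) \<le> \<Lambda> * (u - t)" using u t T by (intro lip) auto
    also have "\<dots> \<le> \<Lambda> * \<delta>" using u \<Lambda> by (intro mult_left_mono) auto
    finally have "\<epsilon> / 2 \<le> norm (x u)"
      using t(2) \<Lambda>\<delta> norm_triangle_ineq2[of "x t" "x u"] by (simp add: norm_minus_commute)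
    then have "\<eta> * (\<epsilon> / 2) ^ 2 \<le> \<eta> * norm (x u) ^ 2"
      using \<epsilon> \<eta> by (intro mult_left_mono power_mono) auto
    then show "V' u \<le> - (\<eta> * (\<epsilon> / 2) ^ 2)" using V'[of u] u t T by simp
  qed (use t T \<delta> in auto)
  ultimately have "V (t + \<delta>) < (INF t\<in>{0..}. V t)"
    using T(2) by (simp add: \<kappa>_def)
  moreover have "(INF t\<in>{0..}. V t) \<le> V (t + \<delta>)"
    using t T \<delta> by (intro cINF_lower bdd) auto
  ultimately show False by simp
qed

text \<open>
  The comparison \<open>\<eta> |x(t)|\<^sup>2 \<le> V(t) \<le> V(0) \<le> C m\<^sup>2\<close> bounds by \<open>B m\<close> every solution
  whose initial function is bounded by \<open>m\<close>, which gives boundedness and stability at once.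
  The bound on \<open>x\<close> bounds \<open>x'\<close> through the equation, and dissipation yields convergence.
\<close>

lemma lyapunov_asymptotically_stable:
  fixes A :: "nat \<Rightarrow> real^'n^'n" and V :: "(real \<Rightarrow> real^'n) \<Rightarrow> real \<Rightarrow> real"
  assumes \<tau>: "\<And>i. i \<le> K \<Longrightarrow> 0 \<le> \<tau> i \<and> \<tau> i \<le> \<tau> K" and \<eta>: "\<eta> > 0" and C: "C \<ge> 0"
    and V: "\<And>x t. continuous_on UNIV x \<Longrightarrow>
      (\<And>t. t \<ge> 0 \<Longrightarrow> (x has_vector_derivative (\<Sum>i=0..K. A i *v x (t - \<tau> i))) (at t within {0..})) \<Longrightarrow>
      t \<ge> 0 \<Longrightarrow>
      \<eta> * norm (x t) ^ 2 \<le> V x t \<and>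
      (\<exists>v'. (V x has_vector_derivative v') (at t within {0..}) \<and> v' \<le> - \<eta> * norm (x t) ^ 2)"
    and upper: "\<And>x m. continuous_on UNIV x \<Longrightarrow> (\<And>s. s \<in> {- \<tau> K..0} \<Longrightarrow> norm (x s) \<le> m) \<Longrightarrow>
      V x 0 \<le> C * m ^ 2"
  shows "dde_asymptotically_stable K \<tau> A"
proof -
  define B where "B = 1 + sqrt (C / \<eta>)"
  have B: "B \<ge> 1" using C \<eta> by (simp add: B_def)
  have \<tau>K: "0 \<le> \<tau> K" using \<tau>[of K] by simp
  have main: "(\<forall>t\<ge>- \<tau> K. norm (x t) \<le> B * m) \<and> (x \<longlongrightarrow> 0) at_top"
    if sol: "dde_solution K \<tau> A \<phi> x" and m: "\<And>s. s \<in> {- \<tau> K..0} \<Longrightarrow> norm (\<phi> s) \<le> m"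
    for \<phi> x m
  proof -
    have m0: "0 \<le> m" using m[of 0] \<tau>K by (auto intro: order_trans[OF norm_ge_zero])
    \<comment> \<open>Extending the solution by a constant to the left makes it continuous on the whole line.\<close>
    define y where "y s = x (max s (- \<tau> K))" for s
    have yx: "y s = x s" if "s \<ge> - \<tau> K" for s using that by (simp add: y_def max_def)
    have ycont: "continuous_on UNIV y"
      unfolding y_def using sol unfolding dde_solution_def
      by (intro continuous_on_compose2[of "{- \<tau> K..}" x UNIV]) (auto intro!: continuous_intros)
    have yd: "(y has_vector_derivative (\<Sum>i=0..K. A i *v y (t - \<tau> i))) (at t within {0..})"
      if t: "t \<ge> 0" for t
    proof -
      have "(x has_vector_derivative (\<Sum>i=0..K. A i *v x (t - \<tau> i))) (at t within {0..})"
        using sol t unfolding dde_solution_def by blast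
      moreover have "(\<Sum>i=0..K. A i *v x (t - \<tau> i)) = (\<Sum>i=0..K. A i *v y (t - \<tau> i))"
      proof (intro sum.cong refl)
        fix i assume "i \<in> {0..K}"
        then have "t - \<tau> i \<ge> - \<tau> K" using \<tau>[of i] t by auto
        then show "A i *v x (t - \<tau> i) = A i *v y (t - \<tau> i)" by (simp add: yx)
      qed
      ultimately show ?thesis
        using has_vector_derivative_transform[of t "{0..}" y x] t \<tau>K yx by auto
    qed
    obtain V' where dV: "\<And>t. t \<ge> 0 \<Longrightarrow> (V y has_vector_derivative V' t) (at t within {0..})"
      and V': "\<And>t. t \<ge> 0 \<Longrightarrow> V' t \<le> - \<eta> * norm (y t) ^ 2"
      using V[OF ycont yd] by metis
    have low: "\<eta> * norm (y t) ^ 2 \<le> V y t" if "t \<ge> 0" for t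
      using V[OF ycont yd that] by blast
    have ym: "norm (y s) \<le> m" if "s \<in> {- \<tau> K..0}" for s
      using m[OF that] that sol unfolding dde_solution_def by (simp add: yx)
    have V0: "V y 0 \<le> C * m ^ 2" by (rule upper[OF ycont ym])
    have bound: "norm (y t) \<le> B * m" if t: "t \<ge> - \<tau> K" for t
    proof (cases "t \<le> 0")
      case True
      then have "norm (y t) \<le> 1 * m" using ym[of t] t by simp
      also have "\<dots> \<le> B * m" using B m0 by (intro mult_right_mono)
      finally show ?thesis .
    next
      case False
      have "V y t \<le> V y 0 - 0 * (t - 0)"
      proof (rule decrease_of_derivative_bound[OF dV])
        fix u assume "u \<in> {0..t}"
        then have "V' u \<le> - \<eta> * norm (y u) ^ 2" by (intro V') auto
        also have "\<dots> \<le> 0" using \<eta> by simp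
        finally show "V' u \<le> - 0" by simp
      qed (use False in auto)
      then have "\<eta> * norm (y t) ^ 2 \<le> C * m ^ 2" using low[of t] V0 False by simp
      then have "norm (y t) ^ 2 \<le> (C / \<eta>) * m ^ 2" using \<eta> by (simp add: field_simps)
      also have "\<dots> = (sqrt (C / \<eta>) * m) ^ 2" using C \<eta> by (simp add: power_mult_distrib)
      finally have "norm (y t) \<le> sqrt (C / \<eta>) * m"
        by (rule power2_le_imp_le) (use C \<eta> m0 in simp)
      then show ?thesis using m0 by (simp add: B_def algebra_simps)
    qed
    define \<Lambda> where "\<Lambda> = (\<Sum>i=0..K. onorm ((*v) (A i)) * (B * m))"
    have slope: "norm (\<Sum>i=0..K. A i *v y (t - \<tau> i)) \<le> \<Lambda>" if t: "t \<ge> 0" for t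
      unfolding \<Lambda>_def
    proof (rule order_trans[OF norm_sum sum_mono])
      fix i assume "i \<in> {0..K}"
      then have "t - \<tau> i \<ge> - \<tau> K" using \<tau>[of i] t by auto
      then have "norm (y (t - \<tau> i)) \<le> B * m" by (rule bound)
      then show "norm (A i *v y (t - \<tau> i)) \<le> onorm ((*v) (A i)) * (B * m)"
        by (intro order_trans[OF onorm[OF matrix_vector_mul_bounded_linear]] mult_left_mono onorm_pos_le
            matrix_vector_mul_bounded_linear)
    qed
    have lip: "norm (y t - y s) \<le> \<Lambda> * (t - s)" if "0 \<le> s" "s \<le> t" for s t
    proof -
      have "norm (y t - y s) \<le> \<Lambda> * norm (t - s)"
      proof (rule differentiable_bound[of "{0..}" y "\<lambda>t h. h *\<^sub>R (\<Sum>i=0..K. A i *v y (t - \<tau> i))"])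
        show "(y has_derivative (\<lambda>h. h *\<^sub>R (\<Sum>i = 0..K. A i *v y (u - \<tau> i)))) (at u within {0..})"
          if "u \<in> {0..}" for u
          using yd[of u] that by (simp add: has_vector_derivative_def)
        show "onorm (\<lambda>h. h *\<^sub>R (\<Sum>i = 0..K. A i *v y (u - \<tau> i))) \<le> \<Lambda>" if "u \<in> {0..}" for u
        proof (rule onorm_le)
          fix h :: real
          show "norm (h *\<^sub>R (\<Sum>i = 0..K. A i *v y (u - \<tau> i))) \<le> \<Lambda> * norm h"
            using mult_left_mono[OF slope[of u], of "norm h"] that by (simp add: mult.commute)
        qed
      qed (use that in auto)
      then show ?thesis using that by simp
    qed
    have nn: "0 \<le> V y t" if "t \<ge> 0" for t
      using low[OF that] \<eta> by (auto intro: order_trans[rotated])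
    have "(y \<longlongrightarrow> 0) at_top"
      by (rule tendsto_zero_of_dissipation[OF dV V' \<eta> nn lip])
    moreover have "eventually (\<lambda>s. y s = x s) at_top"
      using eventually_ge_at_top[of "- \<tau> K"] by eventually_elim (rule yx)
    ultimately have "(x \<longlongrightarrow> 0) at_top" by (simp add: tendsto_cong)
    with bound show ?thesis by (simp add: yx)
  qed
  have bdd: "bdd_above ((\<lambda>t. norm (\<phi> t)) ` {- \<tau> K..0})" if "continuous_on {- \<tau> K..0} \<phi>"
    for \<phi> :: "real \<Rightarrow> real^'n"
    by (intro bounded_imp_bdd_above compact_imp_bounded compact_continuous_image continuous_intros that)
      auto
  have sup: "norm (\<phi> s) \<le> (SUP t\<in>{- \<tau> K..0}. norm (\<phi> t))"
    if "continuous_on {- \<tau> K..0} \<phi>" "s \<in> {- \<tau> K..0}" for \<phi> :: "real \<Rightarrow> real^'n" and s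
    by (rule cSUP_upper[OF that(2) bdd[OF that(1)]])
  show ?thesis
    unfolding dde_asymptotically_stable_def
  proof (intro conjI allI impI; (elim conjE)?)
    fix \<phi> :: "real \<Rightarrow> real^'n" and x
    assume \<phi>: "continuous_on {- \<tau> K..0} \<phi>" and sol: "dde_solution K \<tau> A \<phi> x"
    show "bounded (x ` {- \<tau> K..})"
      using main[OF sol sup[OF \<phi>]] unfolding bounded_iff by (intro exI) auto
    show "(x \<longlongrightarrow> 0) at_top"
      using main[OF sol sup[OF \<phi>]] by blast
  next
    fix \<epsilon> :: real assume \<epsilon>: "\<epsilon> > 0"
    show "\<exists>\<delta>>0. \<forall>\<phi> x. continuous_on {- \<tau> K..0} \<phi> \<and> dde_solution K \<tau> A \<phi> x \<longrightarrow>
        (SUP t\<in>{- \<tau> K..0}. norm (\<phi> t)) < \<delta> \<longrightarrow> (SUP t\<in>{- \<tau> K..}. norm (x t)) < \<epsilon>"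
    proof (intro exI[of _ "\<epsilon> / B"] conjI allI impI; (elim conjE)?)
      show "0 < \<epsilon> / B" using \<epsilon> B by simp
    next
      fix \<phi> :: "real \<Rightarrow> real^'n" and x
      assume \<phi>: "continuous_on {- \<tau> K..0} \<phi>" and sol: "dde_solution K \<tau> A \<phi> x"
        and small: "(SUP t\<in>{- \<tau> K..0}. norm (\<phi> t)) < \<epsilon> / B"
      have "(SUP t\<in>{- \<tau> K..}. norm (x t)) \<le> B * (SUP t\<in>{- \<tau> K..0}. norm (\<phi> t))"
        using main[OF sol sup[OF \<phi>]] by (intro cSUP_least) auto
      also have "\<dots> < \<epsilon>" using small B by (simp add: field_simps)
      finally show "(SUP t\<in>{- \<tau> K..}. norm (x t)) < \<epsilon>" .
    qed
  qed
qed

section \<open>The Lyapunov-Krasovskii functional\<close>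

definition lk_functional ::
  "nat \<Rightarrow> (nat \<Rightarrow> real) \<Rightarrow> real^'n^'n \<Rightarrow> (nat \<Rightarrow> real \<Rightarrow> real^'n^'n) \<Rightarrow> (nat \<Rightarrow> real \<Rightarrow> real^'n^'n)
    \<Rightarrow> (nat \<Rightarrow> nat \<Rightarrow> real \<Rightarrow> real \<Rightarrow> real^'n^'n) \<Rightarrow> (real \<Rightarrow> real^'n) \<Rightarrow> real \<Rightarrow> real" where
  "lk_functional K \<tau> P Q S R x t =
     x t \<bullet> (P *v x t)
     + (\<Sum>i=1..K. 2 * integral (delay_ivl \<tau> i) (\<lambda>\<theta>. x t \<bullet> (Q i \<theta> *v x (t + \<theta>)))
         + integral (delay_ivl \<tau> i) (\<lambda>\<theta>. x (t + \<theta>) \<bullet> (S i \<theta> *v x (t + \<theta>))))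
     + (\<Sum>i=1..K. \<Sum>j=1..K. integral (delay_ivl \<tau> i) (\<lambda>\<theta>. integral (delay_ivl \<tau> j)
         (\<lambda>\<omega>. x (t + \<theta>) \<bullet> (R i j \<theta> \<omega> *v x (t + \<omega>)))))"

locale lk_conditions =
  fixes K d :: nat
    and \<tau> :: "nat \<Rightarrow> real"
    and A :: "nat \<Rightarrow> real^'n^'n"
    and P :: "real^'n^'n"
    and \<eta> :: real
    and Q S :: "nat \<Rightarrow> real \<Rightarrow> real^'n^'n"
    and R :: "nat \<Rightarrow> nat \<Rightarrow> real \<Rightarrow> real \<Rightarrow> real^'n^'n"
  assumes K: "K \<ge> 1" and \<tau>0: "\<tau> 0 = 0"
    and \<tau>_step: "\<And>i. i \<in> {1..K} \<Longrightarrow> \<tau> (i - 1) < \<tau> i"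
    and P: "transpose P = P" and \<eta>: "\<eta> > 0"
    and Q: "\<And>i. i \<in> {1..K} \<Longrightarrow> continuous_on UNIV (Q i)"
    and S: "\<And>i. i \<in> {1..K} \<Longrightarrow> continuous_on UNIV (S i)"
    and Rc: "\<And>i j. i \<in> {1..K} \<Longrightarrow> j \<in> {1..K} \<Longrightarrow> continuous_on UNIV (\<lambda>(\<theta>, \<omega>). R i j \<theta> \<omega>)"
    and R_sym: "\<And>i j \<theta> \<omega>. i \<in> {1..K} \<Longrightarrow> j \<in> {1..K} \<Longrightarrow> R i j \<theta> \<omega> = transpose (R j i \<omega> \<theta>)"
    and M: "M_fam K \<tau> P \<eta> Q S \<in> G1 \<tau> K d"
    and RG: "R \<in> G2 \<tau> K d"
    and D: "(\<lambda>i \<theta> a b. - D_fam K \<tau> A P \<eta> Q S R i \<theta> a b) \<in> G3 \<tau> K d"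
    and L: "L_fam \<tau> R \<in> G2 \<tau> K d"
begin

lemma \<tau>_mono: "i \<le> j \<Longrightarrow> j \<le> K \<Longrightarrow> \<tau> i \<le> \<tau> j"
proof (induction j rule: dec_induct)
  case (step j)
  then show ?case using \<tau>_step[of "Suc j"] by simp
qed simp

lemma \<tau>_bounds: "i \<le> K \<Longrightarrow> 0 \<le> \<tau> i \<and> \<tau> i \<le> \<tau> K"
  using \<tau>_mono[of 0 i] \<tau>_mono[of i K] \<tau>0 by simp

lemma \<tau>K_pos: "\<tau> K > 0"
  using \<tau>_step[of 1] \<tau>_bounds[of 1] K \<tau>0 by simp

lemma delay_ivl_subset:
  assumes "i \<in> {1..K}" "\<theta> \<in> delay_ivl \<tau> i"
  shows "\<theta> \<in> {- \<tau> K..0}"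
proof -
  have "i \<le> K" "i - 1 \<le> K" using assms(1) by auto
  then have "\<tau> i \<le> \<tau> K" "0 \<le> \<tau> (i - 1)" using \<tau>_bounds by blast+
  then show ?thesis using assms(2) by (auto simp: delay_ivl_def)
qed

lemma sum_lengths: "(\<Sum>i=1..K. \<tau> i - \<tau> (i - 1)) = \<tau> K"
  using sum_telescope''[of 0 K \<tau>] \<tau>0 by simp

text \<open>
  A constant integrates to \<open>\<tau>\<^sub>K\<close> times itself because the intervals tile \<open>[-\<tau>\<^sub>K, 0]\<close>.  This
  explains the factors \<open>\<tau>\<^sub>K\<close> in \<open>M\<close> and \<open>D\<close>.
\<close>

lemma sum_integral_affine:
  fixes c :: real and f :: "nat \<Rightarrow> real \<Rightarrow> real"
  assumes f: "\<And>i. i \<in> {1..K} \<Longrightarrow> f i integrable_on delay_ivl \<tau> i"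
  shows "(\<Sum>i=1..K. integral (delay_ivl \<tau> i) (\<lambda>\<theta>. c + \<tau> K * f i \<theta>))
    = \<tau> K * (c + (\<Sum>i=1..K. integral (delay_ivl \<tau> i) (f i)))"
proof -
  have "(\<Sum>i=1..K. integral (delay_ivl \<tau> i) (\<lambda>\<theta>. c + \<tau> K * f i \<theta>))
      = (\<Sum>i=1..K. c * (\<tau> i - \<tau> (i - 1)) + \<tau> K * integral (delay_ivl \<tau> i) (f i))"
  proof (intro sum.cong refl integral_unique has_integral_add)
    fix i assume i: "i \<in> {1..K}"
    show "((\<lambda>\<theta>. c) has_integral c * (\<tau> i - \<tau> (i - 1))) (delay_ivl \<tau> i)"
      using has_integral_const_real[of c "- \<tau> i" "- \<tau> (i - 1)"] \<tau>_step[OF i]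
      by (simp add: delay_ivl_def mult.commute)
    show "((\<lambda>\<theta>. \<tau> K * f i \<theta>) has_integral \<tau> K * integral (delay_ivl \<tau> i) (f i)) (delay_ivl \<tau> i)"
      by (intro has_integral_mult_right integrable_integral f i)
  qed
  also have "\<dots> = \<tau> K * (c + (\<Sum>i=1..K. integral (delay_ivl \<tau> i) (f i)))"
    by (simp only: sum.distrib sum_distrib_left[symmetric] sum_lengths) (simp add: algebra_simps)
  finally show ?thesis .
qed

lemma integrable_inner_matrix:
  fixes H :: "real \<Rightarrow> real^'n^'n" and u v :: "real \<Rightarrow> real^'n"
  assumes "continuous_on (delay_ivl \<tau> i) H" "continuous_on (delay_ivl \<tau> i) u"
    "continuous_on (delay_ivl \<tau> i) v"
  shows "(\<lambda>\<theta>. u \<theta> \<bullet> (H \<theta> *v v \<theta>)) integrable_on delay_ivl \<tau> i"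
  using assms unfolding delay_ivl_def
  by (intro integrable_continuous_interval continuous_on_inner
      bounded_bilinear.continuous_on[OF bounded_bilinear_matrix_vector_mult])

lemma continuous_R_section:
  assumes "i \<in> {1..K}" "j \<in> {1..K}"
  shows "continuous_on X (\<lambda>\<omega>. R i j \<theta> \<omega>)"
proof -
  have "continuous_on X (\<lambda>\<omega>. (\<theta>, \<omega>))"
    using continuous_on_Pair[of X "\<lambda>_. \<theta>" "\<lambda>\<omega>. \<omega>"] by simp
  from continuous_on_compose2[OF Rc[OF assms] this] show ?thesis by simp
qed

lemma Q_deriv:
  assumes i: "i \<in> {1..K}"
  shows "\<theta> \<in> delay_ivl \<tau> i \<Longrightarrow>
      (Q i has_vector_derivative ivl_deriv \<tau> Q i \<theta>) (at \<theta> within delay_ivl \<tau> i)"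
    and "continuous_on (delay_ivl \<tau> i) (ivl_deriv \<tau> Q i)"
proof -
  obtain w where "\<forall>\<theta>\<in>delay_ivl \<tau> i. M_fam K \<tau> P \<eta> Q S i \<theta> 1 2 = (\<chi> p q. poly (w p q) \<theta>)"
    using pos_families_polynomial_block[OF M[unfolded G1_def] i, of 1 2] by auto
  then have w: "\<tau> K *\<^sub>R Q i \<theta> = (\<chi> p q. poly (w p q) \<theta>)" if "\<theta> \<in> delay_ivl \<tau> i" for \<theta>
    using that by (simp add: M_fam_def bordered_def)
  note * = ivl_deriv_polynomial[where X = Q and k = "\<tau> K" and w = w and i = i and \<tau> = \<tau>, OF \<tau>_step[OF i] _ w]
  show "\<theta> \<in> delay_ivl \<tau> i \<Longrightarrow>
      (Q i has_vector_derivative ivl_deriv \<tau> Q i \<theta>) (at \<theta> within delay_ivl \<tau> i)"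
    and "continuous_on (delay_ivl \<tau> i) (ivl_deriv \<tau> Q i)"
    using * \<tau>K_pos by auto
qed

lemma S_deriv:
  assumes i: "i \<in> {1..K}"
  shows "\<theta> \<in> delay_ivl \<tau> i \<Longrightarrow>
      (S i has_vector_derivative ivl_deriv \<tau> S i \<theta>) (at \<theta> within delay_ivl \<tau> i)"
    and "continuous_on (delay_ivl \<tau> i) (ivl_deriv \<tau> S i)"
proof -
  obtain w where "\<forall>\<theta>\<in>delay_ivl \<tau> i. M_fam K \<tau> P \<eta> Q S i \<theta> 2 2 = (\<chi> p q. poly (w p q) \<theta>)"
    using pos_families_polynomial_block[OF M[unfolded G1_def] i, of 2 2] by auto
  then have w: "\<tau> K *\<^sub>R S i \<theta> = (\<chi> p q. poly (w p q) \<theta>)" if "\<theta> \<in> delay_ivl \<tau> i" for \<theta>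
    using that by (simp add: M_fam_def bordered_def)
  note * = ivl_deriv_polynomial[where X = S and k = "\<tau> K" and w = w and i = i and \<tau> = \<tau>, OF \<tau>_step[OF i] _ w]
  show "\<theta> \<in> delay_ivl \<tau> i \<Longrightarrow>
      (S i has_vector_derivative ivl_deriv \<tau> S i \<theta>) (at \<theta> within delay_ivl \<tau> i)"
    and "continuous_on (delay_ivl \<tau> i) (ivl_deriv \<tau> S i)"
    using * \<tau>K_pos by auto
qed

abbreviation V :: "(real \<Rightarrow> real^'n) \<Rightarrow> real \<Rightarrow> real" where
  "V \<equiv> lk_functional K \<tau> P Q S R"

text \<open>
  The value \<open>x(t)\<close> is constant in \<open>\<theta>\<close>, so it can serve as the constant vector paired with the
  multipliers of \<open>M\<close>; the double-integral part is nonnegative by itself.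
\<close>

lemma V_lower:
  assumes x: "continuous_on UNIV x"
  shows "\<eta> * (x t \<bullet> x t) \<le> V x t"
proof -
  note xs = continuous_on_shift[OF x]
  define w where "w = (\<lambda>\<theta> a. if a \<le> (1::nat) then x t else x (t + \<theta>))"
  define q where "q i \<theta> = x t \<bullet> (Q i \<theta> *v x (t + \<theta>))" for i \<theta>
  define s where "s i \<theta> = x (t + \<theta>) \<bullet> (S i \<theta> *v x (t + \<theta>))" for i \<theta>
  have qi: "q i integrable_on delay_ivl \<tau> i" if "i \<in> {1..K}" for i
    unfolding q_def using Q[OF that]
    by (intro integrable_inner_matrix xs continuous_on_const) (rule continuous_on_subset, auto)
  have si: "s i integrable_on delay_ivl \<tau> i" if "i \<in> {1..K}" for i
    unfolding s_def using S[OF that]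
    by (intro integrable_inner_matrix xs) (rule continuous_on_subset, auto)
  have "0 \<le> (\<Sum>i=1..K. integral (delay_ivl \<tau> i) (\<lambda>\<theta>. \<Sum>a=1..1+1. \<Sum>b=1..1+1.
      w \<theta> a \<bullet> (M_fam K \<tau> P \<eta> Q S i \<theta> a b *v w \<theta> b)))"
    unfolding w_def by (rule pos_families_integral_nonneg[OF M[unfolded G1_def] xs])
  also have "\<dots> = (\<Sum>i=1..K. integral (delay_ivl \<tau> i) (\<lambda>\<theta>.
      (x t \<bullet> (P *v x t) - \<eta> * (x t \<bullet> x t)) + \<tau> K * (2 * q i \<theta> + s i \<theta>)))"
    unfolding w_def M_quadratic_form q_def s_def ..
  also have "\<dots> = \<tau> K * ((x t \<bullet> (P *v x t) - \<eta> * (x t \<bullet> x t))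
      + (\<Sum>i=1..K. integral (delay_ivl \<tau> i) (\<lambda>\<theta>. 2 * q i \<theta> + s i \<theta>)))"
    by (intro sum_integral_affine integrable_add integrable_on_mult_right qi si)
  also have "(\<Sum>i=1..K. integral (delay_ivl \<tau> i) (\<lambda>\<theta>. 2 * q i \<theta> + s i \<theta>))
      = (\<Sum>i=1..K. 2 * integral (delay_ivl \<tau> i) (q i) + integral (delay_ivl \<tau> i) (s i))"
    by (intro sum.cong refl integral_unique has_integral_add has_integral_mult_right
        integrable_integral qi si)
  finally have "\<eta> * (x t \<bullet> x t) \<le> x t \<bullet> (P *v x t)
      + (\<Sum>i=1..K. 2 * integral (delay_ivl \<tau> i) (q i) + integral (delay_ivl \<tau> i) (s i))"
    using \<tau>K_pos by (simp add: zero_le_mult_iff)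
  moreover have "0 \<le> (\<Sum>i=1..K. \<Sum>j=1..K. integral (delay_ivl \<tau> i) (\<lambda>\<theta>. integral (delay_ivl \<tau> j)
         (\<lambda>\<omega>. x (t + \<theta>) \<bullet> (R i j \<theta> \<omega> *v x (t + \<omega>)))))"
    by (rule G2_double_integral_nonneg[OF RG xs])
  ultimately show ?thesis
    unfolding lk_functional_def q_def s_def by linarith
qed

text \<open>
  All kernels are continuous, hence bounded on the compact delay intervals and their products.
\<close>

lemma V_upper:
  "\<exists>C\<ge>0. \<forall>x m. (\<forall>s\<in>{- \<tau> K..0}. norm (x s) \<le> m) \<longrightarrow> V x 0 \<le> C * m ^ 2"
proof -
  obtain k where k: "k > 0" and mv: "\<And>(H :: real^'n^'n) v. norm (H *v v) \<le> norm H * norm v * k"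
    using bounded_bilinear.pos_bounded[OF bounded_bilinear_matrix_vector_mult] by blast
  have inner_le: "\<bar>u \<bullet> (H *v v)\<bar> \<le> k * b * m ^ 2"
    if "norm u \<le> m" "norm v \<le> m" "norm H \<le> b" for u v :: "real^'n" and H :: "real^'n^'n" and m b
  proof -
    have "0 \<le> m" "0 \<le> b" using that by (auto intro: order_trans[OF norm_ge_zero])
    have "\<bar>u \<bullet> (H *v v)\<bar> \<le> norm u * norm (H *v v)" by (rule Cauchy_Schwarz_ineq2)
    also have "\<dots> \<le> m * (b * m * k)"
      using that k \<open>0 \<le> m\<close> \<open>0 \<le> b\<close>
      by (intro mult_mono order_trans[OF mv]) auto
    finally show ?thesis by (simp add: power2_eq_square mult_ac)
  qed
  have bd: "\<exists>b\<ge>0. \<forall>z\<in>X. norm (f z) \<le> b"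
    if "compact X" "continuous_on UNIV f" for X :: "'z::topological_space set" and f :: "'z \<Rightarrow> real^'n^'n"
  proof -
    have "bounded (f ` X)"
      using that by (intro compact_imp_bounded compact_continuous_image)
        (auto intro: continuous_on_subset)
    then show ?thesis unfolding bounded_pos by (auto intro: less_imp_le)
  qed
  have "\<forall>i\<in>{1..K}. \<exists>b\<ge>0. \<forall>\<theta>\<in>delay_ivl \<tau> i. norm (Q i \<theta>) \<le> b"
    using bd[OF _ Q] by (auto simp: delay_ivl_def)
  then obtain bQ where bQ: "\<And>i. i \<in> {1..K} \<Longrightarrow> 0 \<le> bQ i"
      "\<And>i \<theta>. i \<in> {1..K} \<Longrightarrow> \<theta> \<in> delay_ivl \<tau> i \<Longrightarrow> norm (Q i \<theta>) \<le> bQ i"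
    by metis
  have "\<forall>i\<in>{1..K}. \<exists>b\<ge>0. \<forall>\<theta>\<in>delay_ivl \<tau> i. norm (S i \<theta>) \<le> b"
    using bd[OF _ S] by (auto simp: delay_ivl_def)
  then obtain bS where bS: "\<And>i. i \<in> {1..K} \<Longrightarrow> 0 \<le> bS i"
      "\<And>i \<theta>. i \<in> {1..K} \<Longrightarrow> \<theta> \<in> delay_ivl \<tau> i \<Longrightarrow> norm (S i \<theta>) \<le> bS i"
    by metis
  have "\<forall>i\<in>{1..K}. \<forall>j\<in>{1..K}. \<exists>b\<ge>0. \<forall>z\<in>delay_ivl \<tau> i \<times> delay_ivl \<tau> j. norm ((\<lambda>(\<theta>, \<omega>). R i j \<theta> \<omega>) z) \<le> b"
    by (intro ballI bd Rc compact_Times) (auto simp: delay_ivl_def)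
  then have "\<forall>i\<in>{1..K}. \<forall>j\<in>{1..K}. \<exists>b\<ge>0. \<forall>\<theta>\<in>delay_ivl \<tau> i. \<forall>\<omega>\<in>delay_ivl \<tau> j. norm (R i j \<theta> \<omega>) \<le> b"
    by simp
  then obtain bR where bR: "\<And>i j. i \<in> {1..K} \<Longrightarrow> j \<in> {1..K} \<Longrightarrow> 0 \<le> bR i j"
      "\<And>i j \<theta> \<omega>. i \<in> {1..K} \<Longrightarrow> j \<in> {1..K} \<Longrightarrow> \<theta> \<in> delay_ivl \<tau> i \<Longrightarrow> \<omega> \<in> delay_ivl \<tau> j \<Longrightarrow>
        norm (R i j \<theta> \<omega>) \<le> bR i j"
    by metis
  define len where "len i = \<tau> i - \<tau> (i - 1)" for i
  have len: "len i \<ge> 0" if "i \<in> {1..K}" for i using \<tau>_step[OF that] by (simp add: len_def)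
  have int_le: "\<bar>integral (delay_ivl \<tau> i) f\<bar> \<le> B * len i"
    if "i \<in> {1..K}" "0 \<le> B" "\<And>\<theta>. \<theta> \<in> delay_ivl \<tau> i \<Longrightarrow> \<bar>f \<theta>\<bar> \<le> B" for i B and f :: "real \<Rightarrow> real"
    using integral_norm_le_length[of "- \<tau> i" "- \<tau> (i - 1)" B f] that \<tau>_step[of i]
    by (simp add: delay_ivl_def len_def)
  define C where "C = k * norm P + (\<Sum>i=1..K. 2 * (k * bQ i * len i) + k * bS i * len i)
      + (\<Sum>i=1..K. \<Sum>j=1..K. k * bR i j * len j * len i)"
  have "C \<ge> 0"
    unfolding C_def using k bQ(1) bS(1) bR(1) len
    by (intro add_nonneg_nonneg sum_nonneg mult_nonneg_nonneg) auto
  moreover have "V x 0 \<le> C * m ^ 2" if x: "\<And>s. s \<in> {- \<tau> K..0} \<Longrightarrow> norm (x s) \<le> m" for x m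
  proof -
    have xi: "norm (x (0 + \<theta>)) \<le> m" if "i \<in> {1..K}" "\<theta> \<in> delay_ivl \<tau> i" for i \<theta>
      using x[OF delay_ivl_subset[OF that]] by simp
    have x0: "norm (x 0) \<le> m" using x[of 0] \<tau>K_pos by simp
    have Pt: "x 0 \<bullet> (P *v x 0) \<le> k * norm P * m ^ 2"
      using inner_le[OF x0 x0 order_refl, of P] by simp
    have Qt: "integral (delay_ivl \<tau> i) (\<lambda>\<theta>. x 0 \<bullet> (Q i \<theta> *v x (0 + \<theta>))) \<le> k * bQ i * m ^ 2 * len i"
      if i: "i \<in> {1..K}" for i
      by (rule order_trans[OF abs_ge_self int_le[OF i]])
        (use k bQ(1)[OF i] in simp, intro inner_le x0 xi[OF i] bQ(2)[OF i])
    have St: "integral (delay_ivl \<tau> i) (\<lambda>\<theta>. x (0 + \<theta>) \<bullet> (S i \<theta> *v x (0 + \<theta>))) \<le> k * bS i * m ^ 2 * len i"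
      if i: "i \<in> {1..K}" for i
      by (rule order_trans[OF abs_ge_self int_le[OF i]])
        (use k bS(1)[OF i] in simp, intro inner_le xi[OF i] bS(2)[OF i])
    have Rt: "integral (delay_ivl \<tau> i) (\<lambda>\<theta>. integral (delay_ivl \<tau> j)
         (\<lambda>\<omega>. x (0 + \<theta>) \<bullet> (R i j \<theta> \<omega> *v x (0 + \<omega>)))) \<le> k * bR i j * m ^ 2 * len j * len i"
      if i: "i \<in> {1..K}" and j: "j \<in> {1..K}" for i j
    proof (rule order_trans[OF abs_ge_self int_le[OF i]])
      show "0 \<le> k * bR i j * m ^ 2 * len j" using k bR(1)[OF i j] len[OF j] by simp
      fix \<theta> assume \<theta>: "\<theta> \<in> delay_ivl \<tau> i"
      show "\<bar>integral (delay_ivl \<tau> j) (\<lambda>\<omega>. x (0 + \<theta>) \<bullet> (R i j \<theta> \<omega> *v x (0 + \<omega>)))\<bar> \<le> k * bR i j * m ^ 2 * len j"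
        by (rule int_le[OF j])
          (use k bR(1)[OF i j] in simp, intro inner_le xi[OF i \<theta>] xi[OF j] bR(2)[OF i j \<theta>])
    qed
    have "V x 0 \<le> k * norm P * m ^ 2
        + (\<Sum>i=1..K. 2 * (k * bQ i * m ^ 2 * len i) + k * bS i * m ^ 2 * len i)
        + (\<Sum>i=1..K. \<Sum>j=1..K. k * bR i j * m ^ 2 * len j * len i)"
      unfolding lk_functional_def
      by (intro add_mono sum_mono mult_left_mono Pt Qt St Rt) auto
    also have "\<dots> = C * m ^ 2"
      unfolding C_def distrib_right sum_distrib_right by (simp only: mult_ac)
    finally show ?thesis .
  qed
  ultimately show ?thesis by blast
qed

lemma R_term_deriv:
  assumes x: "continuous_on UNIV x" and i: "i \<in> {1..K}" and j: "j \<in> {1..K}"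
  shows "((\<lambda>t. integral (delay_ivl \<tau> i) (\<lambda>\<theta>. integral (delay_ivl \<tau> j)
      (\<lambda>\<omega>. x (t + \<theta>) \<bullet> (R i j \<theta> \<omega> *v x (t + \<omega>))))) has_vector_derivative
      integral (delay_ivl \<tau> j) (\<lambda>\<omega>. x (t + - \<tau> (i - 1)) \<bullet> (R i j (- \<tau> (i - 1)) \<omega> *v x (t + \<omega>)))
      - integral (delay_ivl \<tau> j) (\<lambda>\<omega>. x (t + - \<tau> i) \<bullet> (R i j (- \<tau> i) \<omega> *v x (t + \<omega>)))
      + integral (delay_ivl \<tau> i) (\<lambda>\<theta>. x (t + \<theta>) \<bullet> (R i j \<theta> (- \<tau> (j - 1)) *v x (t + - \<tau> (j - 1))))
      - integral (delay_ivl \<tau> i) (\<lambda>\<theta>. x (t + \<theta>) \<bullet> (R i j \<theta> (- \<tau> j) *v x (t + - \<tau> j)))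
      - integral (delay_ivl \<tau> i) (\<lambda>\<theta>. integral (delay_ivl \<tau> j)
          (\<lambda>\<omega>. x (t + \<theta>) \<bullet> (L_fam \<tau> R i j \<theta> \<omega> *v x (t + \<omega>)))))
    (at t within X)"
proof -
  obtain Q\<^sub>0 :: "(nat \<times> 'n) \<times> nat \<Rightarrow> (nat \<times> 'n) \<times> nat \<Rightarrow> real" where
    "\<forall>i\<in>{1..K}. \<forall>j\<in>{1..K}. \<forall>\<theta>\<in>delay_ivl \<tau> i. \<forall>\<omega>\<in>delay_ivl \<tau> j. \<forall>p q.
        R i j \<theta> \<omega> $ p $ q = (\<Sum>r\<in>{..d div 2} \<times> {..d div 2}. Q\<^sub>0 ((i, p), fst r) ((j, q), snd r)
          * seg_scale \<tau> K i \<theta> ^ fst r * seg_scale \<tau> K j \<omega> ^ snd r)"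
    using G2_entries[OF RG] by (elim exE conjE) (rule that)
  note ent = this[rule_format, OF i j]
  note Lent = L_fam_entries[where R = R and i = i and j = j and \<tau> = \<tau> and K = K
      and c = "\<lambda>p q r. Q\<^sub>0 ((i, p), fst r) ((j, q), snd r)" and \<rho> = "{..d div 2} \<times> {..d div 2}",
      OF \<tau>_step[OF i] \<tau>_step[OF j] _ _ ent]
  show ?thesis
    using ent Lent \<tau>_step[OF i] \<tau>_step[OF j]
    unfolding delay_ivl_def
    by (intro has_vector_derivative_double_integral[where \<rho> = "{..d div 2} \<times> {..d div 2}"
          and c = "\<lambda>p q r. Q\<^sub>0 ((i, p), fst r) ((j, q), snd r)"
          and f = "\<lambda>r \<theta>. seg_scale \<tau> K i \<theta> ^ fst r" and f' = "\<lambda>r. seg_monomial_deriv \<tau> K i (fst r)"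
          and g = "\<lambda>r \<omega>. seg_scale \<tau> K j \<omega> ^ snd r" and g' = "\<lambda>r. seg_monomial_deriv \<tau> K j (snd r)"]
        has_vector_derivative_seg_monomial continuous_on_seg_monomial_deriv x) auto
qed

text \<open>
  For fixed \<open>t\<close> the delayed values \<open>z a = x(t - \<tau>\<^sub>a\<^sub>-\<^sub>1)\<close> are constant in \<open>\<theta>\<close>, so they are
  admissible constant vectors for the multipliers of \<open>-D\<close>.
\<close>

lemma V_derivative:
  assumes x: "continuous_on UNIV x"
    and dx: "(x has_vector_derivative (\<Sum>i=0..K. A i *v x (t - \<tau> i))) (at t within X)"
  shows "\<exists>v'. (V x has_vector_derivative v') (at t within X) \<and> v' \<le> - \<eta> * (x t \<bullet> x t)"
proof -
  note xs = continuous_on_shift[OF x]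
  define z where "z a = x (t + - \<tau> (a - 1))" for a
  define x' where "x' = (\<Sum>a=1..K+1. A (a - 1) *v z a)"
  have x'_eq: "(\<Sum>i=0..K. A i *v x (t - \<tau> i)) = x'"
    unfolding x'_def z_def
    using sum.shift_bounds_cl_nat_ivl[of "\<lambda>a. A (a - 1) *v x (t + - \<tau> (a - 1))" 0 1 K] by simp
  have z1: "z 1 = x t" by (simp add: z_def \<tau>0)
  have zi: "x (t + - \<tau> (i - 1)) = z i" "x (t + - \<tau> i) = z (i + 1)" for i
    by (simp_all add: z_def)
  define qx where "qx i = integral (delay_ivl \<tau> i) (\<lambda>\<theta>. x' \<bullet> (Q i \<theta> *v x (t + \<theta>)))" for i
  define qd where "qd i = integral (delay_ivl \<tau> i) (\<lambda>\<theta>. z 1 \<bullet> (ivl_deriv \<tau> Q i \<theta> *v x (t + \<theta>)))" for i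
  define sd where "sd i = integral (delay_ivl \<tau> i) (\<lambda>\<theta>. x (t + \<theta>) \<bullet> (ivl_deriv \<tau> S i \<theta> *v x (t + \<theta>)))" for i
  define r1 where "r1 i j = integral (delay_ivl \<tau> j) (\<lambda>\<omega>. z i \<bullet> (R i j (- \<tau> (i - 1)) \<omega> *v x (t + \<omega>)))" for i j
  define r2 where "r2 i j = integral (delay_ivl \<tau> j) (\<lambda>\<omega>. z (i + 1) \<bullet> (R i j (- \<tau> i) \<omega> *v x (t + \<omega>)))" for i j
  define l where "l i j = integral (delay_ivl \<tau> i) (\<lambda>\<theta>. integral (delay_ivl \<tau> j)
          (\<lambda>\<omega>. x (t + \<theta>) \<bullet> (L_fam \<tau> R i j \<theta> \<omega> *v x (t + \<omega>))))" for i j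
  define bq where "bq i = z 1 \<bullet> (Q i (- \<tau> (i - 1)) *v z i) - z 1 \<bullet> (Q i (- \<tau> i) *v z (i + 1))" for i
  define bs where "bs i = z i \<bullet> (S i (- \<tau> (i - 1)) *v z i) - z (i + 1) \<bullet> (S i (- \<tau> i) *v z (i + 1))" for i
  \<comment> \<open>By the symmetry of \<open>R\<close>, the boundary terms in \<open>\<omega>\<close> are those in \<open>\<theta>\<close> with \<open>i\<close> and \<open>j\<close> exchanged.\<close>
  have r1': "integral (delay_ivl \<tau> i) (\<lambda>\<theta>. x (t + \<theta>) \<bullet> (R i j \<theta> (- \<tau> (j - 1)) *v z j)) = r1 j i"
    and r2': "integral (delay_ivl \<tau> i) (\<lambda>\<theta>. x (t + \<theta>) \<bullet> (R i j \<theta> (- \<tau> j) *v z (j + 1))) = r2 j i"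
    if ij: "i \<in> {1..K}" "j \<in> {1..K}" for i j
    unfolding r1_def r2_def
    by (simp_all only: R_sym[OF ij] inner_transpose_matrix_vector)
  define v' where "v' = 2 * (x t \<bullet> (P *v x')) + (\<Sum>i=1..K. 2 * (qx i + bq i - qd i) + (bs i - sd i))
      + (\<Sum>i=1..K. \<Sum>j=1..K. r1 i j - r2 i j + r1 j i - r2 j i - l i j)"
  have Qder: "((\<lambda>t. integral (delay_ivl \<tau> i) (\<lambda>\<theta>. x t \<bullet> (Q i \<theta> *v x (t + \<theta>)))) has_vector_derivative
      qx i + bq i - qd i) (at t within X)" if i: "i \<in> {1..K}" for i
  proof -
    have "((\<lambda>t. integral (delay_ivl \<tau> i) (\<lambda>\<theta>. x t \<bullet> (Q i \<theta> *v x (t + \<theta>)))) has_vector_derivative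
      qx i + x t \<bullet> (Q i (- \<tau> (i - 1)) *v x (t + - \<tau> (i - 1))) - x t \<bullet> (Q i (- \<tau> i) *v x (t + - \<tau> i))
      - qd i) (at t within X)"
      using Q_deriv[OF i] \<tau>_step[OF i] dx[unfolded x'_eq] unfolding qx_def qd_def z1 delay_ivl_def
      by (intro has_vector_derivative_cross_term x) auto
    then show ?thesis
      unfolding zi(1) unfolding zi(2) bq_def z1 by (rule has_vector_derivative_eq_rhs) simp
  qed
  have Sder: "((\<lambda>t. integral (delay_ivl \<tau> i) (\<lambda>\<theta>. x (t + \<theta>) \<bullet> (S i \<theta> *v x (t + \<theta>)))) has_vector_derivative
      bs i - sd i) (at t within X)" if i: "i \<in> {1..K}" for i
  proof -
    have "((\<lambda>t. integral (delay_ivl \<tau> i) (\<lambda>\<theta>. x (t + \<theta>) \<bullet> (S i \<theta> *v x (t + \<theta>)))) has_vector_derivative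
      x (t + - \<tau> (i - 1)) \<bullet> (S i (- \<tau> (i - 1)) *v x (t + - \<tau> (i - 1)))
      - x (t + - \<tau> i) \<bullet> (S i (- \<tau> i) *v x (t + - \<tau> i)) - sd i) (at t within X)"
      using S_deriv[OF i] \<tau>_step[OF i] unfolding sd_def delay_ivl_def
      by (intro has_vector_derivative_quadratic_term x) auto
    then show ?thesis
      unfolding zi(1) unfolding zi(2) bs_def .
  qed
  have Rder: "((\<lambda>t. integral (delay_ivl \<tau> i) (\<lambda>\<theta>. integral (delay_ivl \<tau> j)
      (\<lambda>\<omega>. x (t + \<theta>) \<bullet> (R i j \<theta> \<omega> *v x (t + \<omega>))))) has_vector_derivative
      r1 i j - r2 i j + r1 j i - r2 j i - l i j) (at t within X)"
    if ij: "i \<in> {1..K}" "j \<in> {1..K}" for i j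
    using R_term_deriv[OF x ij, of t X]
    unfolding zi(1) unfolding zi(2) r1'[OF ij] r2'[OF ij] r1_def[symmetric] r2_def[symmetric] l_def[symmetric] .
  have "(V x has_vector_derivative v') (at t within X)"
    unfolding lk_functional_def v'_def
    by (intro has_vector_derivative_add has_vector_derivative_sum has_vector_derivative_mult_right
        has_vector_derivative_quadratic_form P dx[unfolded x'_eq] Qder Sder Rder)
  moreover have "v' \<le> - \<eta> * (x t \<bullet> x t)"
  proof -
    define c where "c = 2 * (z 1 \<bullet> (P *v x')) + \<eta> * (z 1 \<bullet> z 1) + (\<Sum>i=1..K. 2 * bq i + bs i)"
    define f where "f j \<theta> = 2 * ((\<Sum>i=1..K. z i \<bullet> (R i j (- \<tau> (i - 1)) \<theta> *v x (t + \<theta>))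
          - z (i + 1) \<bullet> (R i j (- \<tau> i) \<theta> *v x (t + \<theta>)))
          + x' \<bullet> (Q j \<theta> *v x (t + \<theta>)) - z 1 \<bullet> (ivl_deriv \<tau> Q j \<theta> *v x (t + \<theta>)))
        - x (t + \<theta>) \<bullet> (ivl_deriv \<tau> S j \<theta> *v x (t + \<theta>))" for j \<theta>
    define w where "w = (\<lambda>\<theta> a. if a \<le> K + 1 then z a else x (t + \<theta>))"
    have f: "(f j has_integral 2 * ((\<Sum>i=1..K. r1 i j - r2 i j) + qx j - qd j) - sd j) (delay_ivl \<tau> j)"
      if j: "j \<in> {1..K}" for j
      unfolding f_def r1_def r2_def qx_def qd_def sd_def
      using Q_deriv(2)[OF j] S_deriv(2)[OF j] continuous_on_subset[OF Q[OF j], of "delay_ivl \<tau> j"]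
      by (intro has_integral_diff has_integral_add has_integral_mult_right has_integral_sum
          integrable_integral integrable_inner_matrix xs continuous_on_const
          continuous_R_section j) auto
    have "0 \<le> (\<Sum>j=1..K. integral (delay_ivl \<tau> j) (\<lambda>\<theta>. \<Sum>a=1..K+1+1. \<Sum>b=1..K+1+1.
        w \<theta> a \<bullet> ((- D_fam K \<tau> A P \<eta> Q S R j \<theta> a b) *v w \<theta> b)))"
      unfolding w_def by (rule pos_families_integral_nonneg[OF D[unfolded G3_def] xs])
    also have "\<dots> = - (\<Sum>j=1..K. integral (delay_ivl \<tau> j) (\<lambda>\<theta>. \<Sum>a=1..K+1+1. \<Sum>b=1..K+1+1.
        w \<theta> a \<bullet> (D_fam K \<tau> A P \<eta> Q S R j \<theta> a b *v w \<theta> b)))"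
      by (simp only: matrix_vector_mult_minus_left inner_minus_right sum_negf integral_neg)
    also have "\<dots> = - (\<Sum>j=1..K. integral (delay_ivl \<tau> j) (\<lambda>\<theta>. c + \<tau> K * f j \<theta>))"
      unfolding w_def D_quadratic_form[of K \<tau> P, OF K \<tau>0 P] c_def f_def x'_def bq_def bs_def ..
    also have "\<dots> = - (\<tau> K * (c + (\<Sum>j=1..K. integral (delay_ivl \<tau> j) (f j))))"
      by (subst sum_integral_affine) (use f in auto)
    also have "(\<Sum>j=1..K. integral (delay_ivl \<tau> j) (f j))
        = (\<Sum>j=1..K. 2 * ((\<Sum>i=1..K. r1 i j - r2 i j) + qx j - qd j) - sd j)"
      by (intro sum.cong refl integral_unique f)
    finally have neg: "c + (\<Sum>j=1..K. 2 * ((\<Sum>i=1..K. r1 i j - r2 i j) + qx j - qd j) - sd j) \<le> 0"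
      using \<tau>K_pos by (simp add: mult_le_0_iff)
    have Lpos: "0 \<le> (\<Sum>i=1..K. \<Sum>j=1..K. l i j)"
      unfolding l_def by (rule G2_double_integral_nonneg[OF L xs])
    have swap: "(\<Sum>j=1..K. \<Sum>i=1..K. r i j) = (\<Sum>i=1..K. \<Sum>j=1..K. r i j)" for r :: "nat \<Rightarrow> nat \<Rightarrow> real"
      by (rule sum.swap)
    have "v' = c + (\<Sum>j=1..K. 2 * ((\<Sum>i=1..K. r1 i j - r2 i j) + qx j - qd j) - sd j)
        - \<eta> * (z 1 \<bullet> z 1) - (\<Sum>i=1..K. \<Sum>j=1..K. l i j)"
      unfolding v'_def c_def z1
      using swap[of r1] swap[of r2]
      by (simp add: sum.distrib sum_subtractf sum_distrib_left[symmetric] algebra_simps)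
    then show ?thesis using neg Lpos unfolding z1 by linarith
  qed
  ultimately show ?thesis by blast
qed

lemma asymptotically_stable: "dde_asymptotically_stable K \<tau> A"
proof -
  obtain C where C: "C \<ge> 0" and upper: "\<And>x m. (\<And>s. s \<in> {- \<tau> K..0} \<Longrightarrow> norm (x s) \<le> m) \<Longrightarrow> V x 0 \<le> C * m ^ 2"
    using V_upper by blast
  show ?thesis
  proof (rule lyapunov_asymptotically_stable[where V = V and \<tau> = \<tau> and K = K and A = A, OF \<tau>_bounds \<eta> C])
    fix x :: "real \<Rightarrow> real^'n" and t :: real
    assume x: "continuous_on UNIV x"
      and dx: "\<And>t. t \<ge> 0 \<Longrightarrow> (x has_vector_derivative (\<Sum>i=0..K. A i *v x (t - \<tau> i))) (at t within {0..})"
      and t: "t \<ge> 0"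
    show "\<eta> * norm (x t) ^ 2 \<le> V x t \<and>
        (\<exists>v'. (V x has_vector_derivative v') (at t within {0..}) \<and> v' \<le> - \<eta> * norm (x t) ^ 2)"
      using V_lower[OF x] V_derivative[OF x dx[OF t]] by (simp add: power2_norm_eq_inner)
  qed (use upper in auto)
qed

end

theorem mainTheorem6:
  fixes K d :: nat
    and \<tau> :: "nat \<Rightarrow> real"
    and A :: "nat \<Rightarrow> real^'n^'n"
    and P :: "real^'n^'n"
    and \<eta> :: real
    and Q S :: "nat \<Rightarrow> real \<Rightarrow> real^'n^'n"
    and R :: "nat \<Rightarrow> nat \<Rightarrow> real \<Rightarrow> real \<Rightarrow> real^'n^'n"
  assumes "K \<ge> 1"
    and "\<tau> 0 = 0"
    and "\<forall>i\<in>{1..K}. \<tau> (i - 1) < \<tau> i"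
    and "even d"
    and "transpose P = P"
    and "\<eta> > 0"
    and "\<forall>i\<in>{1..K}. continuous_on UNIV (Q i)"
    and "\<forall>i\<in>{1..K}. continuous_on UNIV (S i)"
    and "\<forall>i\<in>{1..K}. \<forall>\<theta>. transpose (S i \<theta>) = S i \<theta>"
    and "\<forall>i\<in>{1..K}. \<forall>j\<in>{1..K}. continuous_on UNIV (\<lambda>(\<theta>, \<omega>). R i j \<theta> \<omega>)"
    and "\<forall>i\<in>{1..K}. \<forall>j\<in>{1..K}. \<forall>\<theta> \<omega>. R i j \<theta> \<omega> = transpose (R j i \<omega> \<theta>)"
    and "M_fam K \<tau> P \<eta> Q S \<in> G1 \<tau> K d"
    and "R \<in> G2 \<tau> K d"
    and "(\<lambda>i \<theta> a b. - D_fam K \<tau> A P \<eta> Q S R i \<theta> a b) \<in> G3 \<tau> K d"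
    and "L_fam \<tau> R \<in> G2 \<tau> K d"
  shows "dde_asymptotically_stable K \<tau> A"
proof -
  interpret lk_conditions K d \<tau> A P \<eta> Q S R
    using assms by unfold_locales blast+
  show ?thesis by (rule asymptotically_stable)
qed

end
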